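(* Let $R\subseteq T$ be rings forming a regular conductor square with conductor $C$, and set $A=R/C$, $B=T/C$. Assume that $T$ is flat as an $R$-module, that $C$ is a principal ideal of $T$, and that every non-zero finitely generated ideal $I$ of $R$ satisfies the following condition: there are elements $r,s\in R$ and an ideal $U\subseteq R$ such that $UT=T=rT$ and $rI=sU$, and such that the multiplication maps $I\xrightarrow{r}rI$ and $U\xrightarrow{s}sU$ are isomorphisms. Assume further that $A$ is a (possibly infinite) product $\prod_{\lambda\in\Lambda}A_\lambda$ of integral domains. Then $R$ is coherent if and only if $A$ is coherent; each of these conditions implies that $T$ is coherent, and so is each ring $A_\lambda$.
   Context: All rings are commutative with identity. A conductor square consists of a ring $T$, a subring $R\subseteq T$ such that $R$ and $T$ have a common non-zero ideal, the largest common ideal $C$ of $R$ and $T$ (called the conductor of $T$ into $R$), and the rings $A=R/C$ and $B=T/C$, together with the inclusions $R\hookrightarrow T$, $A\hookrightarrow B$ and the projections $\eta_2\colon R\twoheadrightarrow A$, $\eta_1\colon T\twoheadrightarrow B$; equivalently, $R$ is the pullback $\{(a,t)\in A\times T\mid a=\eta_1(t)\text{ in }B\}$ and $C=\operatorname{Ker}(\eta_1)=\operatorname{Ker}(\eta_2)$ is the largest common ideal. The square is regular if $C$ contains a non-zero-divisor of $T$. A ring is coherent if every finitely generated ideal of it is finitely presented. *)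

theory Defs
  imports "HOL-Algebra.Algebra"
begin

section \<open>Modules\<close>

definition module_hom ::
    "('r, 'p) ring_scheme \<Rightarrow> ('r, 'm, 'q) module_scheme \<Rightarrow> ('r, 'n, 's) module_scheme \<Rightarrow> ('m \<Rightarrow> 'n) set"
  where "module_hom R M N =
    {f \<in> hom (add_monoid M) (add_monoid N).
       \<forall>a \<in> carrier R. \<forall>x \<in> carrier M. f (a \<odot>\<^bsub>M\<^esub> x) = a \<odot>\<^bsub>N\<^esub> f x}"

definition module_iso ::
    "('r, 'p) ring_scheme \<Rightarrow> ('r, 'm, 'q) module_scheme \<Rightarrow> ('r, 'n, 's) module_scheme \<Rightarrow> ('m \<Rightarrow> 'n) set"
  where "module_iso R M N = {f \<in> module_hom R M N. bij_betw f (carrier M) (carrier N)}"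

definition module_span ::
    "('r, 'p) ring_scheme \<Rightarrow> ('r, 'm, 'q) module_scheme \<Rightarrow> 'm set \<Rightarrow> 'm set"
  where "module_span R M S = \<Inter>{H. submodule H R M \<and> S \<subseteq> H}"

text \<open>
  An additive subgroup \<open>S\<close> of a ring \<open>T\<close>, with scalars acting through the multiplication of \<open>T\<close>.
  For a subring \<open>R\<close> of \<open>T\<close> this gives both \<open>T\<close> itself (\<open>S = carrier T\<close>) and the ideals of \<open>R\<close>
  as \<open>R\<close>-modules. The ring multiplication and unit that every module record carries play no role.
\<close>

definition mult_module :: "('a, 'p) ring_scheme \<Rightarrow> 'a set \<Rightarrow> ('a, 'a) module"
  where "mult_module T S =
    \<lparr>carrier = S, monoid.mult = monoid.mult T, one = monoid.one T, ring.zero = ring.zero T, add = ring.add T,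
     smult = monoid.mult T\<rparr>"

definition free_module :: "('a, 'p) ring_scheme \<Rightarrow> nat \<Rightarrow> ('a, nat \<Rightarrow> 'a) module"
  where "free_module R n =
    \<lparr>carrier = {..<n} \<rightarrow>\<^sub>E carrier R,
     monoid.mult = (\<lambda>x y. \<lambda>i\<in>{..<n}. x i \<otimes>\<^bsub>R\<^esub> y i),
     one = (\<lambda>i\<in>{..<n}. \<one>\<^bsub>R\<^esub>),
     ring.zero = (\<lambda>i\<in>{..<n}. \<zero>\<^bsub>R\<^esub>),
     add = (\<lambda>x y. \<lambda>i\<in>{..<n}. x i \<oplus>\<^bsub>R\<^esub> y i),
     smult = (\<lambda>a x. \<lambda>i\<in>{..<n}. a \<otimes>\<^bsub>R\<^esub> x i)\<rparr>"

definition finitely_presented ::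
    "('r, 'p) ring_scheme \<Rightarrow> ('r, 'm, 'q) module_scheme \<Rightarrow> bool"
  where "finitely_presented R M \<longleftrightarrow>
    module R M \<and>
    (\<exists>n. \<exists>f \<in> module_hom R (free_module R n) M.
       f ` carrier (free_module R n) = carrier M \<and>
       (\<exists>S. finite S \<and> S \<subseteq> carrier (free_module R n) \<and>
            {v \<in> carrier (free_module R n). f v = \<zero>\<^bsub>M\<^esub>} = module_span R (free_module R n) S))"


section \<open>Tensor products and flatness\<close>

text \<open>
  \<open>M \<otimes>\<^sub>R N\<close> as an abelian group: the free abelian group on \<open>carrier M \<times> carrier N\<close> modulo the
  subgroup generated by the bilinearity relations. The \<open>R\<close>-module structure is not needed to
  express flatness.
\<close>

definition tensor_rels ::
    "('r, 'p) ring_scheme \<Rightarrow> ('r, 'm, 'q) module_scheme \<Rightarrow> ('r, 'n, 's) module_scheme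
      \<Rightarrow> (('m \<times> 'n) \<Rightarrow>\<^sub>0 int) set"
  where "tensor_rels R M N =
    {frag_of (x \<oplus>\<^bsub>M\<^esub> x', y) - frag_of (x, y) - frag_of (x', y) | x x' y.
       x \<in> carrier M \<and> x' \<in> carrier M \<and> y \<in> carrier N} \<union>
    {frag_of (x, y \<oplus>\<^bsub>N\<^esub> y') - frag_of (x, y) - frag_of (x, y') | x y y'.
       x \<in> carrier M \<and> y \<in> carrier N \<and> y' \<in> carrier N} \<union>
    {frag_of (a \<odot>\<^bsub>M\<^esub> x, y) - frag_of (x, a \<odot>\<^bsub>N\<^esub> y) | a x y.
       a \<in> carrier R \<and> x \<in> carrier M \<and> y \<in> carrier N}"

definition tensor_kernel ::
    "('r, 'p) ring_scheme \<Rightarrow> ('r, 'm, 'q) module_scheme \<Rightarrow> ('r, 'n, 's) module_scheme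
      \<Rightarrow> (('m \<times> 'n) \<Rightarrow>\<^sub>0 int) set"
  where "tensor_kernel R M N =
    generate (free_Abelian_group (carrier M \<times> carrier N)) (tensor_rels R M N)"

definition tensor_product ::
    "('r, 'p) ring_scheme \<Rightarrow> ('r, 'm, 'q) module_scheme \<Rightarrow> ('r, 'n, 's) module_scheme
      \<Rightarrow> (('m \<times> 'n) \<Rightarrow>\<^sub>0 int) set monoid"
  where "tensor_product R M N =
    free_Abelian_group (carrier M \<times> carrier N) Mod tensor_kernel R M N"

text \<open>
  For \<open>g : N \<rightarrow> N'\<close> linear, \<open>tensor_map R M N' g\<close> is \<open>id\<^sub>M \<otimes> g : M \<otimes>\<^sub>R N \<rightarrow> M \<otimes>\<^sub>R N'\<close>,
  \<open>x \<otimes> y \<mapsto> x \<otimes> g y\<close>. All members of a coset \<open>K\<close> have their images in one and the same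
  coset, so the union below is that coset.
\<close>

definition tensor_map ::
    "('r, 'p) ring_scheme \<Rightarrow> ('r, 'm, 'q) module_scheme \<Rightarrow> ('r, 'k, 's) module_scheme
      \<Rightarrow> ('n \<Rightarrow> 'k) \<Rightarrow> (('m \<times> 'n) \<Rightarrow>\<^sub>0 int) set \<Rightarrow> (('m \<times> 'k) \<Rightarrow>\<^sub>0 int) set"
  where "tensor_map R M N' g K =
    (\<Union>p\<in>K. tensor_kernel R M N' #>\<^bsub>free_Abelian_group (carrier M \<times> carrier N')\<^esub>
              frag_extend (\<lambda>(x, y). frag_of (x, g y)) p)"

text \<open>
  \<open>M\<close> is flat if \<open>M \<otimes>\<^sub>R _\<close> preserves injectivity of linear maps. A HOL definition cannot quantify
  over modules on all types, so a type for the test modules has to be chosen. Every countably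
  generated \<open>R\<close>-module is isomorphic to one on \<open>(nat \<Rightarrow> 'r) set\<close>, namely to a quotient of the
  module of finitely supported sequences in \<open>R\<close>. In particular all inclusions \<open>I \<hookrightarrow> R\<close> of finitely
  generated ideals are tested up to isomorphism, and these already imply flatness against
  modules of any size; hence the choice of type loses nothing.
\<close>

definition flat_module ::
    "('r, 'p) ring_scheme \<Rightarrow> ('r, 'm, 'q) module_scheme \<Rightarrow> bool"
  where "flat_module R M \<longleftrightarrow>
    module R M \<and>
    (\<forall>(N :: ('r, (nat \<Rightarrow> 'r) set) module) (N' :: ('r, (nat \<Rightarrow> 'r) set) module) g.
       module R N \<and> module R N' \<and> g \<in> module_hom R N N' \<and> inj_on g (carrier N) \<longrightarrow>
       inj_on (tensor_map R M N' g) (carrier (tensor_product R M N)))"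


section \<open>Coherent rings\<close>

definition fg_ideal :: "'a set \<Rightarrow> ('a, 'p) ring_scheme \<Rightarrow> bool"
  where "fg_ideal I R \<longleftrightarrow> (\<exists>S. finite S \<and> S \<subseteq> carrier R \<and> I = Idl\<^bsub>R\<^esub> S)"

definition coherent_ring :: "('a, 'p) ring_scheme \<Rightarrow> bool"
  where "coherent_ring R \<longleftrightarrow>
    cring R \<and> (\<forall>I. fg_ideal I R \<longrightarrow> finitely_presented R (mult_module R I))"


section \<open>Products of rings\<close>

definition product_ring :: "'l set \<Rightarrow> ('l \<Rightarrow> ('b, 'p) ring_scheme) \<Rightarrow> ('l \<Rightarrow> 'b) ring"
  where "product_ring L G =
    \<lparr>carrier = (\<Pi>\<^sub>E l\<in>L. carrier (G l)),
     monoid.mult = (\<lambda>x y. \<lambda>l\<in>L. x l \<otimes>\<^bsub>G l\<^esub> y l),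
     one = (\<lambda>l\<in>L. \<one>\<^bsub>G l\<^esub>),
     ring.zero = (\<lambda>l\<in>L. \<zero>\<^bsub>G l\<^esub>),
     add = (\<lambda>x y. \<lambda>l\<in>L. x l \<oplus>\<^bsub>G l\<^esub> y l)\<rparr>"


section \<open>Conductor squares\<close>

text \<open>A subring of \<open>T\<close> is given by its carrier \<open>R\<close>; as a ring it is \<open>T\<lparr>carrier := R\<rparr>\<close>.\<close>

definition common_ideal :: "('a, 'p) ring_scheme \<Rightarrow> 'a set \<Rightarrow> 'a set \<Rightarrow> bool"
  where "common_ideal T R I \<longleftrightarrow> ideal I T \<and> ideal I (T\<lparr>carrier := R\<rparr>)"

definition conductor_square :: "('a, 'p) ring_scheme \<Rightarrow> 'a set \<Rightarrow> 'a set \<Rightarrow> bool"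
  where "conductor_square T R C \<longleftrightarrow>
    cring T \<and> subring R T \<and>
    (\<exists>I. common_ideal T R I \<and> I \<noteq> {\<zero>\<^bsub>T\<^esub>}) \<and>
    common_ideal T R C \<and> (\<forall>I. common_ideal T R I \<longrightarrow> I \<subseteq> C)"

definition regular_conductor_square :: "('a, 'p) ring_scheme \<Rightarrow> 'a set \<Rightarrow> 'a set \<Rightarrow> bool"
  where "regular_conductor_square T R C \<longleftrightarrow>
    conductor_square T R C \<and>
    (\<exists>c \<in> C. \<forall>t \<in> carrier T. c \<otimes>\<^bsub>T\<^esub> t = \<zero>\<^bsub>T\<^esub> \<longrightarrow> t = \<zero>\<^bsub>T\<^esub>)"

text \<open>
  The condition on an ideal \<open>I\<close> of \<open>R\<close>. The ideal \<open>UT\<close> is \<open>Idl\<^bsub>T\<^esub> U\<close>, \<open>rT\<close> is \<open>PIdl\<^bsub>T\<^esub> r\<close>, and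
  \<open>rI\<close>, \<open>sU\<close> are the cosets \<open>r <# I\<close>, \<open>s <# U\<close> for the multiplication of \<open>T\<close>.
\<close>

definition conductor_ideal_condition :: "('a, 'p) ring_scheme \<Rightarrow> 'a set \<Rightarrow> 'a set \<Rightarrow> bool"
  where "conductor_ideal_condition T R I \<longleftrightarrow>
    (\<exists>r \<in> R. \<exists>s \<in> R. \<exists>U. ideal U (T\<lparr>carrier := R\<rparr>) \<and>
       Idl\<^bsub>T\<^esub> U = carrier T \<and> PIdl\<^bsub>T\<^esub> r = carrier T \<and>
       r <#\<^bsub>T\<^esub> I = s <#\<^bsub>T\<^esub> U \<and>
       (\<lambda>x. r \<otimes>\<^bsub>T\<^esub> x) \<in>
         module_iso (T\<lparr>carrier := R\<rparr>) (mult_module T I) (mult_module T (r <#\<^bsub>T\<^esub> I)) \<and>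
       (\<lambda>x. s \<otimes>\<^bsub>T\<^esub> x) \<in>
         module_iso (T\<lparr>carrier := R\<rparr>) (mult_module T U) (mult_module T (s <#\<^bsub>T\<^esub> U)))"

end

theory Submission
  imports Defs
begin

text \<open>
  Let \<open>I = (u\<^sub>1, \<dots>, u\<^sub>n)\<close> be a non-zero ideal of \<open>R\<close>. By the condition on ideals, \<open>r u\<^sub>i = s v\<^sub>i\<close> where \<open>r\<close> is
  a unit of \<open>T\<close>, \<open>s\<close> is regular in \<open>T\<close>, and \<open>v\<close> generates the unit ideal of \<open>T\<close>. So \<open>u\<close> and \<open>v\<close> have the
  same relations. The relations of \<open>v\<close> over \<open>T\<close> are generated by the Koszul relations, which are
  finitely many and have entries in \<open>R\<close>; this makes \<open>T\<close> coherent (every vector over \<open>T\<close> is moved into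
  \<open>R\<close> by a regular element of \<open>C\<close>). Writing \<open>1 = \<Sum> w\<^sub>i v\<^sub>i\<close> with \<open>w\<^sub>i \<in> T\<close>, every relation of \<open>v\<close> over \<open>A\<close>
  lifts to one over \<open>R\<close>, and a relation \<open>d\<close> with entries in \<open>C\<close> is a combination of Koszul relations
  with coefficients \<open>w\<^sub>j d\<^sub>k \<in> C\<close>. Hence the relations of \<open>v\<close> over \<open>R\<close> are finitely generated if and only
  if those over \<open>A\<close> are. To come back from \<open>v\<close> to \<open>u\<close> over \<open>A\<close>, one uses that annihilators of elements
  of a product of domains are generated by idempotents.
\<close>

section \<open>Linear maps and submodules\<close>

lemma Pi_choice:
  assumes "\<forall>i\<in>I. \<exists>x\<in>S. P i x"
  shows "\<exists>p \<in> I \<rightarrow> S. \<forall>i\<in>I. P i (p i)"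
  using bchoice[of I "\<lambda>i x. x \<in> S \<and> P i x"] assms by blast

text \<open>This is the condition that \<open>finitely_presented\<close> puts on the kernel,
  isolated so that it can be applied to the relations of any vector.\<close>

definition fg_submodule :: "('r, 'p) ring_scheme \<Rightarrow> ('r, 'm, 'q) module_scheme \<Rightarrow> 'm set \<Rightarrow> bool"
  where "fg_submodule R M K \<longleftrightarrow> (\<exists>S. finite S \<and> S \<subseteq> carrier M \<and> K = module_span R M S)"

text \<open>Once \<open>S\<close> lies in \<open>K\<close>, the submodule \<open>K\<close> is one of
  those over which the span intersects, so the span equals \<open>K\<close> as soon as all of them
  contain \<open>K\<close>. In this form, finite generation is proved by testing an arbitrary
  submodule \<open>H\<close> that contains the proposed generators.\<close>

lemma fg_submodule_iff:
  assumes "submodule K R M"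
  shows "fg_submodule R M K \<longleftrightarrow>
    (\<exists>S. finite S \<and> S \<subseteq> K \<and> (\<forall>H. submodule H R M \<and> S \<subseteq> H \<longrightarrow> K \<subseteq> H))"
proof -
  have "K \<subseteq> carrier M"
    using assms by (auto simp: submodule_def subgroup_def)
  then show ?thesis
    using assms unfolding fg_submodule_def module_span_def by (intro iff_exI) blast
qed

lemma (in module) submoduleI':
  assumes "H \<subseteq> carrier M" "\<zero>\<^bsub>M\<^esub> \<in> H"
    and "\<And>x y. x \<in> H \<Longrightarrow> y \<in> H \<Longrightarrow> x \<oplus>\<^bsub>M\<^esub> y \<in> H"
    and "\<And>a x. a \<in> carrier R \<Longrightarrow> x \<in> H \<Longrightarrow> a \<odot>\<^bsub>M\<^esub> x \<in> H"
  shows "submodule H R M"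
proof (rule submoduleI)
  fix x assume x: "x \<in> H"
  then have "\<ominus>\<^bsub>M\<^esub> x = (\<ominus>\<one>) \<odot>\<^bsub>M\<^esub> x"
    using assms(1) smult_l_minus[of \<one> x] by auto
  then show "\<ominus>\<^bsub>M\<^esub> x \<in> H"
    using assms(4) x by simp
qed (use assms in auto)

lemma (in module) submodule_iff:
  "submodule H R M \<longleftrightarrow> H \<subseteq> carrier M \<and> \<zero>\<^bsub>M\<^esub> \<in> H \<and> (\<forall>x\<in>H. \<forall>y\<in>H. x \<oplus>\<^bsub>M\<^esub> y \<in> H) \<and>
    (\<forall>a\<in>carrier R. \<forall>x\<in>H. a \<odot>\<^bsub>M\<^esub> x \<in> H)"
proof
  assume H: "submodule H R M"
  then have "\<zero>\<^bsub>M\<^esub> \<in> H"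
    using subgroup.one_closed[OF submodule.axioms(1)] by fastforce
  then show "H \<subseteq> carrier M \<and> \<zero>\<^bsub>M\<^esub> \<in> H \<and> (\<forall>x\<in>H. \<forall>y\<in>H. x \<oplus>\<^bsub>M\<^esub> y \<in> H) \<and>
    (\<forall>a\<in>carrier R. \<forall>x\<in>H. a \<odot>\<^bsub>M\<^esub> x \<in> H)"
    using submoduleE[OF H] by auto
qed (auto intro: submoduleI')

lemma (in module) submodule_finsum:
  assumes "submodule H R M" "finite J" "\<And>j. j \<in> J \<Longrightarrow> g j \<in> H"
  shows "finsum M g J \<in> H"
  using assms(2,3)
proof (induction J rule: finite_induct)
  case empty
  then show ?case using assms(1) by (simp add: submodule_iff)
next
  case (insert j J)
  then have "g \<in> J \<rightarrow> carrier M" "g j \<in> carrier M"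
    using assms(1) by (auto simp: submodule_iff)
  then show ?case
    using insert assms(1) by (auto simp: submodule_iff)
qed

lemma module_homD:
  assumes "f \<in> module_hom R M N"
  shows "x \<in> carrier M \<Longrightarrow> f x \<in> carrier N"
    and "x \<in> carrier M \<Longrightarrow> y \<in> carrier M \<Longrightarrow> f (x \<oplus>\<^bsub>M\<^esub> y) = f x \<oplus>\<^bsub>N\<^esub> f y"
    and "a \<in> carrier R \<Longrightarrow> x \<in> carrier M \<Longrightarrow> f (a \<odot>\<^bsub>M\<^esub> x) = a \<odot>\<^bsub>N\<^esub> f x"
  using assms by (auto simp: module_hom_def hom_def)

lemma module_homI:
  assumes "\<And>x. x \<in> carrier M \<Longrightarrow> f x \<in> carrier N"
    and "\<And>x y. x \<in> carrier M \<Longrightarrow> y \<in> carrier M \<Longrightarrow> f (x \<oplus>\<^bsub>M\<^esub> y) = f x \<oplus>\<^bsub>N\<^esub> f y"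
    and "\<And>a x. a \<in> carrier R \<Longrightarrow> x \<in> carrier M \<Longrightarrow> f (a \<odot>\<^bsub>M\<^esub> x) = a \<odot>\<^bsub>N\<^esub> f x"
  shows "f \<in> module_hom R M N"
  using assms by (auto simp: module_hom_def hom_def)

lemma module_hom_zero:
  assumes "module R M" "module R N" "f \<in> module_hom R M N"
  shows "f \<zero>\<^bsub>M\<^esub> = \<zero>\<^bsub>N\<^esub>"
proof -
  interpret M: module R M by fact
  interpret N: module R N by fact
  have "f (\<zero>\<^bsub>R\<^esub> \<odot>\<^bsub>M\<^esub> \<zero>\<^bsub>M\<^esub>) = \<zero>\<^bsub>R\<^esub> \<odot>\<^bsub>N\<^esub> f \<zero>\<^bsub>M\<^esub>"
    by (intro module_homD[OF assms(3)]) auto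
  then show ?thesis
    using module_homD(1)[OF assms(3)] by simp
qed

lemma module_hom_comp:
  assumes "f \<in> module_hom R M N" "g \<in> module_hom R N P"
  shows "(\<lambda>x. g (f x)) \<in> module_hom R M P"
  using assms by (auto intro!: module_homI simp: module_homD)

lemma submodule_vimage:
  assumes "module R M" "module R N" "f \<in> module_hom R M N" "submodule H R N"
  shows "submodule {x \<in> carrier M. f x \<in> H} R M"
proof -
  interpret M: module R M by fact
  interpret N: module R N by fact
  show ?thesis
    using assms(4) module_homD[OF assms(3)] module_hom_zero[OF assms(1-3)]
    by (auto simp: M.submodule_iff N.submodule_iff)
qed

text \<open>This is why two linear maps that agree on generators agree everywhere.\<close>

lemma submodule_equalizer:
  assumes "module R M" "module R N" "f \<in> module_hom R M N" "g \<in> module_hom R M N"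
  shows "submodule {x \<in> carrier M. f x = g x} R M"
proof -
  interpret M: module R M by fact
  interpret N: module R N by fact
  show ?thesis
    using module_homD[OF assms(3)] module_hom_zero[OF assms(1-3)]
      module_homD[OF assms(4)] module_hom_zero[OF assms(1,2,4)]
    by (auto simp: M.submodule_iff)
qed

lemma module_hom_diff:
  assumes "module R M" "module R N" "f \<in> module_hom R M N" "g \<in> module_hom R M N"
  shows "(\<lambda>x. f x \<ominus>\<^bsub>N\<^esub> g x) \<in> module_hom R M N"
proof -
  interpret M: module R M by fact
  interpret N: module R N by fact
  note f = module_homD[OF assms(3)] and g = module_homD[OF assms(4)]
  show ?thesis
  proof (rule module_homI)
    fix x y assume "x \<in> carrier M" "y \<in> carrier M"
    then have "f x \<in> carrier N" "f y \<in> carrier N" "g x \<in> carrier N" "g y \<in> carrier N"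
      and "f (x \<oplus>\<^bsub>M\<^esub> y) = f x \<oplus>\<^bsub>N\<^esub> f y" "g (x \<oplus>\<^bsub>M\<^esub> y) = g x \<oplus>\<^bsub>N\<^esub> g y"
      using f g by auto
    then show "f (x \<oplus>\<^bsub>M\<^esub> y) \<ominus>\<^bsub>N\<^esub> g (x \<oplus>\<^bsub>M\<^esub> y) = f x \<ominus>\<^bsub>N\<^esub> g x \<oplus>\<^bsub>N\<^esub> (f y \<ominus>\<^bsub>N\<^esub> g y)"
      by (simp add: N.minus_eq N.minus_add N.M.add.m_ac)
  next
    fix a x assume "a \<in> carrier R" "x \<in> carrier M"
    then show "f (a \<odot>\<^bsub>M\<^esub> x) \<ominus>\<^bsub>N\<^esub> g (a \<odot>\<^bsub>M\<^esub> x) = a \<odot>\<^bsub>N\<^esub> (f x \<ominus>\<^bsub>N\<^esub> g x)"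
      using f g by (simp add: N.minus_eq N.smult_r_distr N.smult_r_minus)
  qed (use f g in \<open>auto simp: N.minus_eq\<close>)
qed

section \<open>Free modules and relations\<close>

lemma free_module_simps [simp]:
  "carrier (free_module R n) = {..<n} \<rightarrow>\<^sub>E carrier R"
  "\<zero>\<^bsub>free_module R n\<^esub> = (\<lambda>i\<in>{..<n}. \<zero>\<^bsub>R\<^esub>)"
  "x \<oplus>\<^bsub>free_module R n\<^esub> y = (\<lambda>i\<in>{..<n}. x i \<oplus>\<^bsub>R\<^esub> y i)"
  "a \<odot>\<^bsub>free_module R n\<^esub> x = (\<lambda>i\<in>{..<n}. a \<otimes>\<^bsub>R\<^esub> x i)"
  by (simp_all add: free_module_def)

lemma mult_module_simps [simp]:
  "carrier (mult_module R I) = I"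
  "\<zero>\<^bsub>mult_module R I\<^esub> = \<zero>\<^bsub>R\<^esub>"
  "x \<oplus>\<^bsub>mult_module R I\<^esub> y = x \<oplus>\<^bsub>R\<^esub> y"
  "a \<odot>\<^bsub>mult_module R I\<^esub> x = a \<otimes>\<^bsub>R\<^esub> x"
  by (simp_all add: mult_module_def)

lemma finsum_mult_module [simp]:
  "finsum (mult_module R (carrier R)) f J = finsum R f J"
  by (simp add: finsum_def finprod_def mult_module_def)

text \<open>The vector \<open>w\<close> precedes the coefficients so that
  \<open>lincomb M n w\<close> is itself the linear map on the free module that sends the unit
  vectors to the entries of \<open>w\<close>.\<close>

definition lincomb :: "('r, 'm, 'q) module_scheme \<Rightarrow> nat \<Rightarrow> (nat \<Rightarrow> 'm) \<Rightarrow> (nat \<Rightarrow> 'r) \<Rightarrow> 'm"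
  where "lincomb M n w a = (\<Oplus>\<^bsub>M\<^esub>i\<in>{..<n}. a i \<odot>\<^bsub>M\<^esub> w i)"

text \<open>The first syzygy module of the entries of \<open>u\<close>, that is, the kernel of the
  linear form with coefficients \<open>u\<close>.\<close>

definition relations :: "('r, 'p) ring_scheme \<Rightarrow> nat \<Rightarrow> (nat \<Rightarrow> 'r) \<Rightarrow> (nat \<Rightarrow> 'r) set"
  where "relations R n u =
    {a \<in> {..<n} \<rightarrow>\<^sub>E carrier R. (\<Oplus>\<^bsub>R\<^esub>i\<in>{..<n}. a i \<otimes>\<^bsub>R\<^esub> u i) = \<zero>\<^bsub>R\<^esub>}"

abbreviation fg_relations :: "('r, 'p) ring_scheme \<Rightarrow> nat \<Rightarrow> (nat \<Rightarrow> 'r) \<Rightarrow> bool"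
  where "fg_relations R n u \<equiv> fg_submodule R (free_module R n) (relations R n u)"

context cring
begin

lemma module_free_module: "module R (free_module R n)"
proof (rule moduleI)
  show "abelian_group (free_module R n)"
  proof (rule abelian_groupI)
    fix x assume x: "x \<in> carrier (free_module R n)"
    then have "(\<lambda>i\<in>{..<n}. \<ominus> x i) \<in> carrier (free_module R n)"
      "(\<lambda>i\<in>{..<n}. \<ominus> x i) \<oplus>\<^bsub>free_module R n\<^esub> x = \<zero>\<^bsub>free_module R n\<^esub>"
      by (auto simp: PiE_iff l_neg intro!: restrict_ext)
    then show "\<exists>y\<in>carrier (free_module R n). y \<oplus>\<^bsub>free_module R n\<^esub> x = \<zero>\<^bsub>free_module R n\<^esub>"
      by blast
  next
    fix x assume "x \<in> carrier (free_module R n)"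
    then show "\<zero>\<^bsub>free_module R n\<^esub> \<oplus>\<^bsub>free_module R n\<^esub> x = x"
      by (auto simp: PiE_iff fun_eq_iff extensional_def)
  qed (auto simp: PiE_iff a_ac intro!: restrict_ext)
next
  fix x assume "x \<in> carrier (free_module R n)"
  then show "\<one> \<odot>\<^bsub>free_module R n\<^esub> x = x"
    by (auto simp: PiE_iff fun_eq_iff extensional_def)
qed (auto simp: PiE_iff l_distr r_distr m_assoc intro!: restrict_ext is_cring)

lemma module_mult_module:
  assumes "ideal I R"
  shows "module R (mult_module R I)"
proof -
  interpret I: ideal I R by fact
  note [simp] = I.Icarr I.I_l_closed
  show ?thesis
  proof (rule moduleI)
    show "abelian_group (mult_module R I)"
    proof (rule abelian_groupI)
      fix x assume "x \<in> carrier (mult_module R I)"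
      then show "\<exists>y\<in>carrier (mult_module R I). y \<oplus>\<^bsub>mult_module R I\<^esub> x = \<zero>\<^bsub>mult_module R I\<^esub>"
        by (auto intro!: bexI[of _ "\<ominus>x"] simp: l_neg)
    qed (auto simp: a_ac)
  qed (auto simp: l_distr r_distr m_assoc is_cring)
qed

lemma module_self: "module R (mult_module R (carrier R))"
  by (rule module_mult_module[OF oneideal])

definition unit_vec :: "nat \<Rightarrow> nat \<Rightarrow> nat \<Rightarrow> 'a"
  where "unit_vec n j = (\<lambda>i\<in>{..<n}. if i = j then \<one> else \<zero>)"

lemma unit_vec_closed [simp]: "unit_vec n j \<in> {..<n} \<rightarrow>\<^sub>E carrier R"
  by (auto simp: unit_vec_def)

lemma finsum_free_module:
  assumes "finite J" "\<And>j. j \<in> J \<Longrightarrow> g j \<in> {..<n} \<rightarrow>\<^sub>E carrier R" "i < n"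
  shows "finsum (free_module R n) g J i = (\<Oplus>j\<in>J. g j i)"
proof -
  interpret F: module R "free_module R n" by (rule module_free_module)
  show ?thesis
    using assms(1,2)
  proof (induction J rule: finite_induct)
    case (insert j J)
    then have "g \<in> J \<rightarrow> {..<n} \<rightarrow>\<^sub>E carrier R" "g j \<in> {..<n} \<rightarrow>\<^sub>E carrier R"
      "(\<lambda>j. g j i) \<in> J \<rightarrow> carrier R" "g j i \<in> carrier R"
      using assms(3) by auto
    then show ?case
      using insert assms(3) by simp
  qed (use assms(3) in simp)
qed

lemma finsum_delta:
  assumes "finite J" "k \<in> J" "a \<in> carrier R"
  shows "(\<Oplus>i\<in>J. if i = k then a else \<zero>) = a"
  using add.finprod_singleton_swap[of k J "\<lambda>_. a"] assms by simp

lemma free_module_expand: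
  assumes a: "a \<in> {..<n} \<rightarrow>\<^sub>E carrier R"
  shows "(\<Oplus>\<^bsub>free_module R n\<^esub>j\<in>{..<n}. a j \<odot>\<^bsub>free_module R n\<^esub> unit_vec n j) = a"
    (is "?s = a")
proof -
  interpret F: module R "free_module R n" by (rule module_free_module)
  have u: "a j \<odot>\<^bsub>free_module R n\<^esub> unit_vec n j \<in> carrier (free_module R n)" if "j < n" for j
    using that a by (intro F.smult_closed) auto
  have s: "?s \<in> {..<n} \<rightarrow>\<^sub>E carrier R"
    using F.finsum_closed[of "\<lambda>j. a j \<odot>\<^bsub>free_module R n\<^esub> unit_vec n j" "{..<n}"] u
    by (auto simp del: free_module_simps(4))
  show ?thesis
  proof (rule PiE_ext[OF s a])
    fix i assume i: "i \<in> {..<n}"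
    then have ai: "a i \<in> carrier R" using a by auto
    have "?s i = (\<Oplus>j\<in>{..<n}. (a j \<odot>\<^bsub>free_module R n\<^esub> unit_vec n j) i)"
      using u i by (intro finsum_free_module) auto
    also have "\<dots> = (\<Oplus>j\<in>{..<n}. if j = i then a i else \<zero>)"
      using i a by (intro finsum_cong') (auto simp: unit_vec_def PiE_iff)
    also have "\<dots> = a i"
      using i ai by (intro finsum_delta) auto
    finally show "?s i = a i" .
  qed
qed

text \<open>Every vector is the combination of the unit vectors with its own entries as
  coefficients. Applied to the preimage of a submodule under a linear map, this reduces a membership
  claim about all vectors to the unit vectors.\<close>

lemma submodule_free_module_eq_carrier:
  assumes "submodule H R (free_module R n)" "\<And>j. j < n \<Longrightarrow> unit_vec n j \<in> H"
  shows "H = {..<n} \<rightarrow>\<^sub>E carrier R"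
proof -
  interpret F: module R "free_module R n" by (rule module_free_module)
  have "a \<in> H" if a: "a \<in> {..<n} \<rightarrow>\<^sub>E carrier R" for a
  proof -
    have "a j \<odot>\<^bsub>free_module R n\<^esub> unit_vec n j \<in> H" if "j < n" for j
      using submodule.smult_closed[OF assms(1), of "a j"] assms(2)[OF that] a that by fastforce
    then have "(\<Oplus>\<^bsub>free_module R n\<^esub>j\<in>{..<n}. a j \<odot>\<^bsub>free_module R n\<^esub> unit_vec n j) \<in> H"
      by (intro F.submodule_finsum[OF assms(1)]) auto
    then show ?thesis
      using free_module_expand[OF a] by simp
  qed
  then show ?thesis
    using assms(1) by (auto simp: F.submodule_iff)
qed

lemma module_hom_free_module_eqI:
  assumes "module R M" "f \<in> module_hom R (free_module R n) M" "g \<in> module_hom R (free_module R n) M"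
    and "\<And>j. j < n \<Longrightarrow> f (unit_vec n j) = g (unit_vec n j)" "a \<in> {..<n} \<rightarrow>\<^sub>E carrier R"
  shows "f a = g a"
  using submodule_free_module_eq_carrier[OF submodule_equalizer[OF module_free_module assms(1-3)]]
    assms(4,5) by auto

lemma lincomb_hom:
  assumes "module R M" "w \<in> {..<n} \<rightarrow> carrier M"
  shows "lincomb M n w \<in> module_hom R (free_module R n) M"
proof -
  interpret M: module R M by fact
  show ?thesis
  proof (rule module_homI)
    fix a assume "a \<in> carrier (free_module R n)"
    then show "lincomb M n w a \<in> carrier M"
      unfolding lincomb_def using assms(2) by (intro M.finsum_closed) auto
  next
    fix a b assume ab: "a \<in> carrier (free_module R n)" "b \<in> carrier (free_module R n)"
    have "lincomb M n w (a \<oplus>\<^bsub>free_module R n\<^esub> b) = (\<Oplus>\<^bsub>M\<^esub>i\<in>{..<n}. a i \<odot>\<^bsub>M\<^esub> w i \<oplus>\<^bsub>M\<^esub> b i \<odot>\<^bsub>M\<^esub> w i)"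
      unfolding lincomb_def using assms(2) ab
      by (intro M.finsum_cong') (auto simp: PiE_iff Pi_iff M.smult_l_distr)
    also have "\<dots> = lincomb M n w a \<oplus>\<^bsub>M\<^esub> lincomb M n w b"
      unfolding lincomb_def using assms(2) ab
      by (intro M.finsum_addf) auto
    finally show "lincomb M n w (a \<oplus>\<^bsub>free_module R n\<^esub> b) = lincomb M n w a \<oplus>\<^bsub>M\<^esub> lincomb M n w b" .
  next
    fix c a assume ca: "c \<in> carrier R" "a \<in> carrier (free_module R n)"
    have "lincomb M n w (c \<odot>\<^bsub>free_module R n\<^esub> a) = (\<Oplus>\<^bsub>M\<^esub>i\<in>{..<n}. c \<odot>\<^bsub>M\<^esub> (a i \<odot>\<^bsub>M\<^esub> w i))"
      unfolding lincomb_def using assms(2) ca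
      by (intro M.finsum_cong') (auto simp: PiE_iff Pi_iff M.smult_assoc1)
    also have "\<dots> = c \<odot>\<^bsub>M\<^esub> lincomb M n w a"
      unfolding lincomb_def using assms(2) ca
      by (intro M.finsum_smult_ldistr[symmetric]) auto
    finally show "lincomb M n w (c \<odot>\<^bsub>free_module R n\<^esub> a) = c \<odot>\<^bsub>M\<^esub> lincomb M n w a" .
  qed
qed

lemma lincomb_unit_vec:
  assumes "module R M" "w \<in> {..<n} \<rightarrow> carrier M" "j < n"
  shows "lincomb M n w (unit_vec n j) = w j"
proof -
  interpret M: module R M by fact
  have "lincomb M n w (unit_vec n j) = (\<Oplus>\<^bsub>M\<^esub>i\<in>{..<n}. if i = j then w i else \<zero>\<^bsub>M\<^esub>)"
    unfolding lincomb_def using assms(2)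
    by (intro M.finsum_cong') (auto simp: unit_vec_def Pi_iff)
  also have "\<dots> = w j"
    using assms(2,3) by (intro M.add.finprod_singleton_swap) auto
  finally show ?thesis .
qed

abbreviation dot :: "nat \<Rightarrow> (nat \<Rightarrow> 'a) \<Rightarrow> (nat \<Rightarrow> 'a) \<Rightarrow> 'a"
  where "dot n u a \<equiv> lincomb (mult_module R (carrier R)) n u a"

lemma dot_eq: "dot n u a = (\<Oplus>i\<in>{..<n}. a i \<otimes> u i)"
  by (simp add: lincomb_def)

lemma dot_hom: "u \<in> {..<n} \<rightarrow> carrier R \<Longrightarrow> dot n u \<in> module_hom R (free_module R n) (mult_module R (carrier R))"
  using lincomb_hom[OF module_self] by simp

lemma dot_unit_vec: "u \<in> {..<n} \<rightarrow> carrier R \<Longrightarrow> j < n \<Longrightarrow> dot n u (unit_vec n j) = u j"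
  using lincomb_unit_vec[OF module_self] by simp

lemma relations_eq: "relations R n u = {a \<in> carrier (free_module R n). dot n u a = \<zero>}"
  by (simp add: relations_def dot_eq)

lemma submodule_relations:
  assumes "u \<in> {..<n} \<rightarrow> carrier R"
  shows "submodule (relations R n u) R (free_module R n)"
proof -
  have "submodule {\<zero>} R (mult_module R (carrier R))"
    by (intro module.submoduleI'[OF module_self]) auto
  from submodule_vimage[OF module_free_module module_self dot_hom[OF assms] this]
  show ?thesis by (simp add: relations_eq)
qed

text \<open>Vectors of ring elements are plain functions that need not be extensional, so only
  agreement below \<open>n\<close> can be expected.\<close>

lemma relations_cong:
  assumes "v \<in> {..<n} \<rightarrow> carrier R" "\<And>i. i < n \<Longrightarrow> u i = v i"
  shows "relations R n u = relations R n v"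
proof -
  have "dot n u a = dot n v a" if "a \<in> carrier (free_module R n)" for a
    unfolding dot_eq using assms that by (intro finsum_cong') auto
  then show ?thesis unfolding relations_eq by auto
qed

lemma dot_smult:
  assumes "u \<in> {..<n} \<rightarrow> carrier R" "r \<in> carrier R" "a \<in> carrier (free_module R n)"
  shows "dot n (\<lambda>i. r \<otimes> u i) a = r \<otimes> dot n u a"
proof -
  have "dot n (\<lambda>i. r \<otimes> u i) a = (\<Oplus>i\<in>{..<n}. r \<otimes> (a i \<otimes> u i))"
    unfolding dot_eq using assms by (intro finsum_cong') (auto simp: PiE_iff Pi_iff m_ac)
  then show ?thesis
    unfolding dot_eq using assms by (subst finsum_rdistr) auto
qed

text \<open>The dot product with \<open>r u\<close> is \<open>r\<close> times the dot product with
  \<open>u\<close>, and a regular \<open>r\<close> can be cancelled.\<close>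

lemma relations_smult_regular:
  assumes u: "u \<in> {..<n} \<rightarrow> carrier R" and r: "r \<in> carrier R"
    and reg: "\<And>x. x \<in> carrier R \<Longrightarrow> r \<otimes> x = \<zero> \<Longrightarrow> x = \<zero>"
  shows "relations R n (\<lambda>i. r \<otimes> u i) = relations R n u"
proof -
  have "r \<otimes> dot n u a = \<zero> \<longleftrightarrow> dot n u a = \<zero>" if "a \<in> carrier (free_module R n)" for a
    using module_homD(1)[OF dot_hom[OF u] that] reg r by auto
  then show ?thesis
    using dot_smult[OF u r] unfolding relations_eq by (intro Collect_cong) (metis (no_types, lifting))
qed

text \<open>Every vector is a relation here, and the unit vectors generate. This settles the zero
  ideal, about which the condition on ideals says nothing.\<close>

lemma fg_relations_zero:
  assumes "\<And>i. i < n \<Longrightarrow> u i = \<zero>"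
  shows "fg_relations R n u"
proof -
  have "dot n u a = \<zero>" if "a \<in> carrier (free_module R n)" for a
  proof -
    have "dot n u a = (\<Oplus>i\<in>{..<n}. \<zero>)"
      unfolding dot_eq using assms that by (intro finsum_cong') (auto simp: PiE_iff)
    then show ?thesis by simp
  qed
  then have rel: "relations R n u = carrier (free_module R n)" by (auto simp: relations_eq)
  have sub: "submodule (relations R n u) R (free_module R n)"
    unfolding rel by (rule module.carrier_is_submodule[OF module_free_module])
  have "relations R n u \<subseteq> H"
    if "submodule H R (free_module R n)" "unit_vec n ` {..<n} \<subseteq> H" for H
    using submodule_free_module_eq_carrier[OF that(1)] that(2) rel by auto
  then show ?thesis
    unfolding fg_submodule_iff[OF sub] by (intro exI[of _ "unit_vec n ` {..<n}"]) (simp add: rel image_subset_iff)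
qed

section \<open>Finitely generated ideals, finite presentation and coherence\<close>

lemma dot_in_ideal:
  assumes "ideal I R" "u \<in> {..<n} \<rightarrow> I" "a \<in> {..<n} \<rightarrow>\<^sub>E carrier R"
  shows "dot n u a \<in> I"
proof -
  interpret I: ideal I R by fact
  have "submodule I R (mult_module R (carrier R))"
    by (intro module.submoduleI'[OF module_self]) (auto simp: I.I_l_closed)
  then have "finsum (mult_module R (carrier R)) (\<lambda>i. a i \<otimes> u i) {..<n} \<in> I"
    using assms(2,3) by (intro module.submodule_finsum[OF module_self]) (auto intro!: I.I_l_closed)
  then show ?thesis by (simp add: dot_eq)
qed

text \<open>The linear combinations of the entries of \<open>u\<close> form an ideal containing
  these entries, and they lie in every ideal that does. Each element of the ideal thus comes from a
  coefficient vector.\<close>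

lemma genideal_image:
  assumes u: "u \<in> {..<n} \<rightarrow> carrier R"
  shows "Idl (u ` {..<n}) = dot n u ` ({..<n} \<rightarrow>\<^sub>E carrier R)"
proof
  note hom = module_homD[OF dot_hom[OF u]]
  interpret F: module R "free_module R n" by (rule module_free_module)
  have "ideal (dot n u ` carrier (free_module R n)) R"
  proof (rule idealI)
    show "subgroup (dot n u ` carrier (free_module R n)) (add_monoid R)"
    proof (rule add.subgroupI)
      fix x assume "x \<in> dot n u ` carrier (free_module R n)"
      then obtain a where a: "a \<in> carrier (free_module R n)" "x = dot n u a" by blast
      then have "\<ominus> x = dot n u ((\<ominus> \<one>) \<odot>\<^bsub>free_module R n\<^esub> a)"
        using hom(1)[of a] hom(3)[of "\<ominus>\<one>" a] by (simp add: l_minus)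
      then show "\<ominus> x \<in> dot n u ` carrier (free_module R n)"
        using F.smult_closed[of "\<ominus> \<one>", OF _ a(1)] by blast
    next
      fix x y assume "x \<in> dot n u ` carrier (free_module R n)" "y \<in> dot n u ` carrier (free_module R n)"
      then show "x \<oplus> y \<in> dot n u ` carrier (free_module R n)"
        using hom(2)[symmetric] F.M.a_closed by (auto simp del: free_module_simps)
    next
      \<comment> \<open>\<open>unit_vec n 0\<close> serves only as some element of the free module;
        it lies there even for \<open>n = 0\<close>.\<close>
      show "dot n u ` carrier (free_module R n) \<noteq> {}"
        using unit_vec_closed[of n 0] by (metis empty_iff free_module_simps(1) image_is_empty)
    qed (use hom(1) in auto)
  next
    fix x y assume "x \<in> dot n u ` carrier (free_module R n)" and y: "y \<in> carrier R"
    then obtain a where a: "a \<in> carrier (free_module R n)" "x = dot n u a" by blast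
    then have "y \<otimes> x = dot n u (y \<odot>\<^bsub>free_module R n\<^esub> a)"
      using hom(3)[of y a] y by simp
    then show "y \<otimes> x \<in> dot n u ` carrier (free_module R n)"
      using F.smult_closed[OF y a(1)] by blast
    then show "x \<otimes> y \<in> dot n u ` carrier (free_module R n)"
      using hom(1)[OF a(1)] y a(2) by (simp add: m_comm)
  qed (rule ring_axioms)
  moreover have "u ` {..<n} \<subseteq> dot n u ` carrier (free_module R n)"
  proof
    fix x assume "x \<in> u ` {..<n}"
    then obtain j where j: "j < n" "x = u j" by auto
    then have "x = dot n u (unit_vec n j)" using dot_unit_vec[OF u j(1)] by simp
    then show "x \<in> dot n u ` carrier (free_module R n)" by simp
  qed
  ultimately show "Idl (u ` {..<n}) \<subseteq> dot n u ` ({..<n} \<rightarrow>\<^sub>E carrier R)"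
    using genideal_minimal by simp
  have sub: "u ` {..<n} \<subseteq> carrier R" using u by auto
  show "dot n u ` ({..<n} \<rightarrow>\<^sub>E carrier R) \<subseteq> Idl (u ` {..<n})"
    using genideal_self[OF sub] dot_in_ideal[OF genideal_ideal[OF sub], of u n]
    by (auto simp: image_subset_iff_funcset)
qed

text \<open>The linear form \<open>dot n u\<close> is the required presentation: its image is the
  ideal and its kernel is the module of relations.\<close>

lemma finitely_presented_genideal:
  assumes u: "u \<in> {..<n} \<rightarrow> carrier R" and fg: "fg_relations R n u"
  shows "finitely_presented R (mult_module R (Idl (u ` {..<n})))"
proof -
  let ?I = "Idl (u ` {..<n})"
  have "ideal ?I R" using u by (intro genideal_ideal) auto
  moreover have "dot n u \<in> module_hom R (free_module R n) (mult_module R ?I)"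
    using module_homD[OF dot_hom[OF u]] genideal_image[OF u] by (auto intro!: module_homI)
  moreover have "dot n u ` carrier (free_module R n) = ?I"
    using genideal_image[OF u] by simp
  moreover have "{v \<in> carrier (free_module R n). dot n u v = \<zero>} = relations R n u"
    by (simp add: relations_eq)
  ultimately show ?thesis
    using fg unfolding finitely_presented_def fg_submodule_def
    by (intro conjI module_mult_module exI[of _ n] bexI[of _ "dot n u"]) (simp_all del: free_module_simps)
qed

text \<open>
  Schanuel's argument: \<open>finitely_presented\<close> only provides some generating system with finitely
  generated relations, but it and \<open>u\<close> are linear combinations of each other.
\<close>

lemma fg_relations_genideal:
  assumes u: "u \<in> {..<n} \<rightarrow> carrier R"
    and fp: "finitely_presented R (mult_module R (Idl (u ` {..<n})))"
  shows "fg_relations R n u"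
proof -
  let ?I = "Idl (u ` {..<n})"
  have I: "ideal ?I R" using u by (intro genideal_ideal) auto
  have I_carrier: "?I \<subseteq> carrier R" using I by (meson ideal.Icarr subsetI)
  obtain m f S where f: "f \<in> module_hom R (free_module R m) (mult_module R ?I)"
    and surj: "f ` carrier (free_module R m) = ?I"
    and S: "finite S" "S \<subseteq> carrier (free_module R m)"
    and ker: "{v \<in> carrier (free_module R m). f v = \<zero>} = module_span R (free_module R m) S"
    using fp unfolding finitely_presented_def by (simp del: free_module_simps) blast
  let ?Fm = "free_module R m" and ?Fn = "free_module R n"
  interpret Fn: module R ?Fn by (rule module_free_module)
  interpret Fm: module R ?Fm by (rule module_free_module)
  have f': "f \<in> module_hom R ?Fm (mult_module R (carrier R))"
    using module_homD[OF f] I_carrier by (intro module_homI) auto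
  have "\<forall>i\<in>{..<n}. \<exists>x\<in>carrier ?Fm. f x = u i"
  proof
    fix i assume "i \<in> {..<n}"
    moreover have "u ` {..<n} \<subseteq> carrier R" using u by auto
    ultimately have "u i \<in> f ` carrier ?Fm" unfolding surj using genideal_self by blast
    then show "\<exists>x\<in>carrier ?Fm. f x = u i" by (auto simp del: free_module_simps)
  qed
  from Pi_choice[OF this]
  obtain p where p: "p \<in> {..<n} \<rightarrow> carrier ?Fm" "\<forall>i\<in>{..<n}. f (p i) = u i" ..
  have "\<forall>j\<in>{..<m}. \<exists>x\<in>carrier ?Fn. dot n u x = f (unit_vec m j)"
  proof
    fix j
    have "f (unit_vec m j) \<in> ?I" using surj by auto
    then show "\<exists>x\<in>carrier ?Fn. dot n u x = f (unit_vec m j)"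
      using genideal_image[OF u] by auto
  qed
  from Pi_choice[OF this]
  obtain q where q: "q \<in> {..<m} \<rightarrow> carrier ?Fn"
      "\<forall>j\<in>{..<m}. dot n u (q j) = f (unit_vec m j)" ..
  \<comment> \<open>\<open>?P\<close> and \<open>?Q\<close> lift the identity of the ideal to the
    two free modules: \<open>f\<close> after \<open>?P\<close> is \<open>dot n u\<close>, and
    \<open>dot n u\<close> after \<open>?Q\<close> is \<open>f\<close>.\<close>
  let ?P = "lincomb ?Fm n p" and ?Q = "lincomb ?Fn m q"
  note P = lincomb_hom[OF module_free_module p(1)] and Q = lincomb_hom[OF module_free_module q(1)]
  have fP: "f (?P a) = dot n u a" if "a \<in> carrier ?Fn" for a
  proof (rule module_hom_free_module_eqI[OF module_self module_hom_comp[OF P f'] dot_hom[OF u]])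
    fix j assume "j < n"
    then show "f (?P (unit_vec n j)) = dot n u (unit_vec n j)"
      using p by (simp add: lincomb_unit_vec[OF module_free_module p(1)] dot_unit_vec[OF u])
  qed (use that in simp)
  have uQ: "dot n u (?Q b) = f b" if "b \<in> carrier ?Fm" for b
  proof (rule module_hom_free_module_eqI[OF module_self module_hom_comp[OF Q dot_hom[OF u]] f'])
    fix j assume "j < m"
    then show "dot n u (?Q (unit_vec m j)) = f (unit_vec m j)"
      using q by (simp add: lincomb_unit_vec[OF module_free_module q(1)])
  qed (use that in simp)
  \<comment> \<open>\<open>?Q (?P a)\<close> and \<open>a\<close> have the same dot product with
    \<open>u\<close>, so the values of \<open>?D\<close> are relations of \<open>u\<close>.\<close>
  let ?D = "\<lambda>a. a \<ominus>\<^bsub>?Fn\<^esub> ?Q (?P a)"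
  have id: "(\<lambda>a. a) \<in> module_hom R ?Fn ?Fn" by (auto intro!: module_homI)
  have D: "?D \<in> module_hom R ?Fn ?Fn"
    by (rule module_hom_diff[OF module_free_module module_free_module id module_hom_comp[OF P Q]])
  have decomp: "a = ?D a \<oplus>\<^bsub>?Fn\<^esub> ?Q (?P a)" if a: "a \<in> carrier ?Fn" for a
  proof -
    have "?Q (?P a) \<in> carrier ?Fn" using module_homD(1)[OF Q] module_homD(1)[OF P] a by blast
    then show ?thesis
      using a by (simp add: Fn.minus_eq Fn.M.a_assoc Fn.M.l_neg del: free_module_simps)
  qed
  \<comment> \<open>A relation \<open>a\<close> is \<open>?D a\<close> plus
    \<open>?Q (?P a)\<close>. The second part comes from the kernel of \<open>f\<close> and needs
    the images of \<open>S\<close>; the first needs the values of \<open>?D\<close> at the unit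
    vectors.\<close>
  let ?S = "?Q ` S \<union> (\<lambda>i. ?D (unit_vec n i)) ` {..<n}"
  have "?Q s \<in> relations R n u" if "s \<in> S" for s
  proof -
    have "s \<in> module_span R ?Fm S" using that by (auto simp: module_span_def)
    then have s: "s \<in> carrier ?Fm" "f s = \<zero>" using ker by blast+
    then show ?thesis using uQ[OF s(1)] module_homD(1)[OF Q s(1)] by (simp add: relations_eq)
  qed
  moreover have "?D a \<in> relations R n u" if a: "a \<in> carrier ?Fn" for a
  proof -
    have c: "?D a \<in> carrier ?Fn" "?P a \<in> carrier ?Fm" "?Q (?P a) \<in> carrier ?Fn"
      using module_homD(1)[OF D a] module_homD(1)[OF P a] module_homD(1)[OF Q] by auto
    have "dot n u a = dot n u (?D a \<oplus>\<^bsub>?Fn\<^esub> ?Q (?P a))" using decomp[OF a] by simp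
    also have "\<dots> = dot n u (?D a) \<oplus> dot n u a"
      using module_homD(2)[OF dot_hom[OF u] c(1,3)] uQ[OF c(2)] fP[OF a] by simp
    finally have "dot n u (?D a) = \<zero>"
      using module_homD(1)[OF dot_hom[OF u]] a c(1) by (simp del: free_module_simps)
    then show ?thesis using c(1) by (simp add: relations_eq)
  qed
  ultimately have "?S \<subseteq> relations R n u" by auto
  moreover have "relations R n u \<subseteq> H" if H: "submodule H R ?Fn" "?S \<subseteq> H" for H
  proof
    fix a assume "a \<in> relations R n u"
    then have a: "a \<in> carrier ?Fn" "dot n u a = \<zero>" by (auto simp: relations_eq)
    have "?P a \<in> {v \<in> carrier ?Fm. f v = \<zero>}"
      using a fP module_homD(1)[OF P] by auto
    moreover have "submodule {b \<in> carrier ?Fm. ?Q b \<in> H} R ?Fm"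
      by (rule submodule_vimage[OF module_free_module module_free_module Q H(1)])
    moreover have "S \<subseteq> {b \<in> carrier ?Fm. ?Q b \<in> H}" using S H(2) by auto
    ultimately have "?Q (?P a) \<in> H" unfolding ker module_span_def by blast
    moreover have "{x \<in> carrier ?Fn. ?D x \<in> H} = carrier ?Fn"
      using submodule_free_module_eq_carrier[OF submodule_vimage[OF module_free_module module_free_module D H(1)]]
        H(2) by auto
    then have "?D a \<in> H" using a(1) by blast
    ultimately have "?D a \<oplus>\<^bsub>?Fn\<^esub> ?Q (?P a) \<in> H"
      using H(1) unfolding Fn.submodule_iff by blast
    then show "a \<in> H"
      using decomp[OF a(1)] by simp
  qed
  ultimately show ?thesis
    using S(1) unfolding fg_submodule_iff[OF submodule_relations[OF u]] by (intro exI[of _ ?S]) auto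
qed

lemma fg_ideal_iff:
  "fg_ideal I R \<longleftrightarrow> (\<exists>(n::nat) u. u \<in> {..<n} \<rightarrow> carrier R \<and> I = Idl (u ` {..<n}))"
proof
  assume "fg_ideal I R"
  then obtain S where S: "finite S" "S \<subseteq> carrier R" "I = Idl S" by (auto simp: fg_ideal_def)
  obtain n and u :: "nat \<Rightarrow> 'a" where "S = u ` {i. i < n}"
    using finite_imp_nat_seg_image_inj_on[OF S(1)] by blast
  then have "S = u ` {..<n}" by auto
  then have "u \<in> {..<n} \<rightarrow> carrier R" "I = Idl (u ` {..<n})"
    using S(2,3) by auto
  then show "\<exists>(n::nat) u. u \<in> {..<n} \<rightarrow> carrier R \<and> I = Idl (u ` {..<n})"
    by (intro exI[of _ n] exI[of _ u] conjI)
next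
  assume "\<exists>(n::nat) u. u \<in> {..<n} \<rightarrow> carrier R \<and> I = Idl (u ` {..<n})"
  then obtain n :: nat and u where "u \<in> {..<n} \<rightarrow> carrier R" "I = Idl (u ` {..<n})"
    by (elim exE conjE)
  then show "fg_ideal I R"
    unfolding fg_ideal_def by (intro exI[of _ "u ` {..<n}"]) auto
qed

text \<open>Whether the relations are finitely generated does not depend on the finite generating
  vector chosen for an ideal. Coherence thus becomes a statement about all finite vectors, with zero
  entries and repetitions allowed.\<close>

lemma coherent_ring_iff_fg_relations:
  "coherent_ring R \<longleftrightarrow> (\<forall>n::nat. \<forall>u \<in> {..<n} \<rightarrow> carrier R. fg_relations R n u)"
proof
  assume R: "coherent_ring R"
  show "\<forall>n::nat. \<forall>u \<in> {..<n} \<rightarrow> carrier R. fg_relations R n u"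
  proof (intro allI ballI)
    fix n :: nat and u assume u: "u \<in> {..<n} \<rightarrow> carrier R"
    then have "fg_ideal (Idl (u ` {..<n})) R" unfolding fg_ideal_iff by (intro exI[of _ n] exI[of _ u] conjI refl)
    then show "fg_relations R n u"
      using R by (intro fg_relations_genideal[OF u]) (simp add: coherent_ring_def)
  qed
next
  assume fg: "\<forall>n::nat. \<forall>u \<in> {..<n} \<rightarrow> carrier R. fg_relations R n u"
  have "finitely_presented R (mult_module R I)" if I: "fg_ideal I R" for I
  proof -
    obtain n :: nat and u where "u \<in> {..<n} \<rightarrow> carrier R" "I = Idl (u ` {..<n})"
      using I unfolding fg_ideal_iff by (elim exE conjE)
    then show ?thesis using fg finitely_presented_genideal by simp
  qed
  then show "coherent_ring R" by (simp add: coherent_ring_def is_cring)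
qed

section \<open>Koszul relations of a vector\<close>

text \<open>For unit vectors \<open>b = e\<^sub>k\<close> these are the Koszul relations \<open>v\<^sub>j e\<^sub>k - v\<^sub>k e\<^sub>j\<close>.\<close>

definition koszul :: "nat \<Rightarrow> (nat \<Rightarrow> 'a) \<Rightarrow> nat \<Rightarrow> (nat \<Rightarrow> 'a) \<Rightarrow> nat \<Rightarrow> 'a"
  where "koszul n v j b =
    v j \<odot>\<^bsub>free_module R n\<^esub> b \<oplus>\<^bsub>free_module R n\<^esub> (\<ominus> dot n v b) \<odot>\<^bsub>free_module R n\<^esub> unit_vec n j"

text \<open>The dot product with \<open>v\<close> is \<open>v j\<close> times
  \<open>dot n v b\<close> minus the same product in the other order. The vector \<open>b\<close>
  may be arbitrary; it need not be a relation.\<close>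

lemma koszul_relations:
  assumes v: "v \<in> {..<n} \<rightarrow> carrier R" and "j < n" and b: "b \<in> carrier (free_module R n)"
  shows "koszul n v j b \<in> relations R n v"
proof -
  interpret F: module R "free_module R n" by (rule module_free_module)
  note dot = module_homD[OF dot_hom[OF v]]
  have vj: "v j \<in> carrier R" using assms by auto
  have db: "dot n v b \<in> carrier R" using dot(1)[OF b] by simp
  have e: "unit_vec n j \<in> carrier (free_module R n)" by simp
  have c: "v j \<odot>\<^bsub>free_module R n\<^esub> b \<in> carrier (free_module R n)"
    "(\<ominus> dot n v b) \<odot>\<^bsub>free_module R n\<^esub> unit_vec n j \<in> carrier (free_module R n)"
    using vj db b e by (intro F.smult_closed; simp del: free_module_simps)+
  have "dot n v (koszul n v j b) = v j \<otimes> dot n v b \<oplus> (\<ominus> dot n v b) \<otimes> v j"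
    unfolding koszul_def using dot(2)[OF c] dot(3)[OF vj b] dot(3)[OF _ e, of "\<ominus> dot n v b"] db
    by (simp add: dot_unit_vec[OF v assms(2)] del: free_module_simps)
  also have "\<dots> = \<zero>"
    using vj db by (simp add: l_minus r_neg m_comm[of "v j"])
  finally show ?thesis
    using F.M.a_closed[OF c] by (simp add: relations_eq koszul_def del: free_module_simps)
qed

text \<open>Linearity in \<open>b\<close> makes every \<open>koszul n v j b\<close> a combination of
  the finitely many ones in which \<open>b\<close> is a unit vector.\<close>

lemma koszul_hom:
  assumes v: "v \<in> {..<n} \<rightarrow> carrier R" and "j < n"
  shows "koszul n v j \<in> module_hom R (free_module R n) (free_module R n)"
proof (rule module_homI)
  note dot = module_homD[OF dot_hom[OF v]]
  have vj: "v j \<in> carrier R" using assms by auto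
  have e: "unit_vec n j \<in> carrier (free_module R n)" by simp
  {
    fix b assume b: "b \<in> carrier (free_module R n)"
    then show "koszul n v j b \<in> carrier (free_module R n)"
      using koszul_relations[OF assms b] by (simp add: relations_eq)
  next
    fix a b assume ab: "a \<in> carrier (free_module R n)" "b \<in> carrier (free_module R n)"
    have d: "dot n v a \<in> carrier R" "dot n v b \<in> carrier R" using ab dot(1) by auto
    have "dot n v (a \<oplus>\<^bsub>free_module R n\<^esub> b) = dot n v a \<oplus> dot n v b"
      using dot(2)[OF ab] by simp
    then show "koszul n v j (a \<oplus>\<^bsub>free_module R n\<^esub> b) = koszul n v j a \<oplus>\<^bsub>free_module R n\<^esub> koszul n v j b"
      unfolding koszul_def using ab e vj d
      by (auto simp: PiE_iff r_distr l_distr minus_add a_ac intro!: restrict_ext)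
  next
    fix c a assume ca: "c \<in> carrier R" "a \<in> carrier (free_module R n)"
    have d: "dot n v a \<in> carrier R" using ca dot(1) by auto
    have "dot n v (c \<odot>\<^bsub>free_module R n\<^esub> a) = c \<otimes> dot n v a"
      using dot(3)[OF ca] by simp
    then show "koszul n v j (c \<odot>\<^bsub>free_module R n\<^esub> a) = c \<odot>\<^bsub>free_module R n\<^esub> koszul n v j a"
      unfolding koszul_def using ca e vj d
      by (auto simp: PiE_iff r_distr l_minus r_minus m_ac intro!: restrict_ext)
  }
qed

text \<open>For a relation \<open>b\<close> the correction along \<open>unit_vec n j\<close>
  vanishes, so \<open>koszul n v j b\<close> is just \<open>v j\<close> times \<open>b\<close>;
  linearity in \<open>b\<close> leaves only unit vectors to check.\<close>

lemma smult_relation_in_koszul_span: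
  assumes v: "v \<in> {..<n} \<rightarrow> carrier R" and j: "j < n" and b: "b \<in> relations R n v"
    and H: "submodule H R (free_module R n)" "\<And>k. k < n \<Longrightarrow> koszul n v j (unit_vec n k) \<in> H"
  shows "v j \<odot>\<^bsub>free_module R n\<^esub> b \<in> H"
proof -
  have b': "b \<in> carrier (free_module R n)" "dot n v b = \<zero>"
    using b by (simp_all add: relations_eq)
  have "{x \<in> carrier (free_module R n). koszul n v j x \<in> H} = {..<n} \<rightarrow>\<^sub>E carrier R"
    using H(2)
    by (intro submodule_free_module_eq_carrier submodule_vimage[OF module_free_module module_free_module koszul_hom[OF v j] H(1)])
      simp
  then have "koszul n v j b \<in> H" using b' by auto
  moreover have "koszul n v j b = v j \<odot>\<^bsub>free_module R n\<^esub> b"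
    using b' v j by (auto simp: koszul_def PiE_iff Pi_iff unit_vec_def intro!: restrict_ext)
  ultimately show ?thesis by simp
qed

end

section \<open>Change of rings\<close>

abbreviation map_vec :: "nat \<Rightarrow> ('a \<Rightarrow> 'b) \<Rightarrow> (nat \<Rightarrow> 'a) \<Rightarrow> nat \<Rightarrow> 'b"
  where "map_vec n h a \<equiv> (\<lambda>i\<in>{..<n}. h (a i))"

context ring_hom_cring
begin

lemma map_vec_closed: "a \<in> carrier (free_module R n) \<Longrightarrow> map_vec n h a \<in> carrier (free_module S n)"
  by auto

lemma dot_map_vec:
  assumes "u \<in> {..<n} \<rightarrow> carrier R" "a \<in> carrier (free_module R n)"
  shows "S.dot n (\<lambda>i. h (u i)) (map_vec n h a) = h (R.dot n u a)"
proof -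
  have "h (R.dot n u a) = (\<Oplus>\<^bsub>S\<^esub>i\<in>{..<n}. h (a i \<otimes> u i))"
    unfolding R.dot_eq using assms by (subst hom_finsum) (auto simp: o_def)
  also have "\<dots> = S.dot n (\<lambda>i. h (u i)) (map_vec n h a)"
    unfolding S.dot_eq using assms by (intro S.finsum_cong') (auto simp: PiE_iff Pi_iff)
  finally show ?thesis by simp
qed

text \<open>\<open>map_vec n h\<close> is only semilinear along \<open>h\<close>: the two free
  modules have different scalars, so \<open>submodule_vimage\<close> does not cover this
  case.\<close>

lemma submodule_vimage_map_vec:
  assumes "submodule H S (free_module S n)"
  shows "submodule {x \<in> carrier (free_module R n). map_vec n h x \<in> H} R (free_module R n)"
proof -
  note R_iff = module.submodule_iff[OF R.module_free_module]
    and S_iff = module.submodule_iff[OF S.module_free_module]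
  have "map_vec n h (x \<oplus>\<^bsub>free_module R n\<^esub> y) = map_vec n h x \<oplus>\<^bsub>free_module S n\<^esub> map_vec n h y"
    if "x \<in> carrier (free_module R n)" "y \<in> carrier (free_module R n)" for x y
    using that by (simp add: PiE_iff cong: restrict_cong)
  moreover have "map_vec n h (a \<odot>\<^bsub>free_module R n\<^esub> x) = h a \<odot>\<^bsub>free_module S n\<^esub> map_vec n h x"
    if "a \<in> carrier R" "x \<in> carrier (free_module R n)" for a x
    using that by (simp add: PiE_iff cong: restrict_cong)
  moreover have "map_vec n h \<zero>\<^bsub>free_module R n\<^esub> = \<zero>\<^bsub>free_module S n\<^esub>"
    by (simp add: PiE_iff cong: restrict_cong)
  moreover have "submodule (carrier (free_module R n)) R (free_module R n)"
    by (rule module.carrier_is_submodule[OF R.module_free_module])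
  ultimately show ?thesis
    using assms hom_closed unfolding R_iff S_iff by (simp del: free_module_simps)
qed

text \<open>A scalar of \<open>S\<close> has to be lifted to \<open>R\<close> before it can act on
  an element of \<open>H\<close>, hence the surjectivity of \<open>h\<close>.\<close>

lemma submodule_image_map_vec:
  assumes surj: "h ` carrier R = carrier S" and H: "submodule H R (free_module R n)"
  shows "submodule (map_vec n h ` H) S (free_module S n)"
proof -
  note R_iff = module.submodule_iff[OF R.module_free_module]
    and S_iff = module.submodule_iff[OF S.module_free_module]
  have sub: "H \<subseteq> carrier (free_module R n)" using H unfolding R_iff by blast
  show ?thesis
  proof (rule module.submoduleI'[OF S.module_free_module])
    show "map_vec n h ` H \<subseteq> carrier (free_module S n)"
      using sub map_vec_closed by blast
    have "\<zero>\<^bsub>free_module S n\<^esub> = map_vec n h \<zero>\<^bsub>free_module R n\<^esub>"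
      by (simp add: PiE_iff cong: restrict_cong)
    then show "\<zero>\<^bsub>free_module S n\<^esub> \<in> map_vec n h ` H"
      using H unfolding R_iff by blast
  next
    fix x y assume "x \<in> map_vec n h ` H" "y \<in> map_vec n h ` H"
    then obtain a b where ab: "a \<in> H" "b \<in> H" "x = map_vec n h a" "y = map_vec n h b" by blast
    then have "a \<oplus>\<^bsub>free_module R n\<^esub> b \<in> H"
      using H unfolding R_iff by blast
    moreover have "a \<in> carrier (free_module R n)" "b \<in> carrier (free_module R n)"
      using ab sub by blast+
    then have "x \<oplus>\<^bsub>free_module S n\<^esub> y = map_vec n h (a \<oplus>\<^bsub>free_module R n\<^esub> b)"
      using ab by (simp add: PiE_iff cong: restrict_cong)
    ultimately show "x \<oplus>\<^bsub>free_module S n\<^esub> y \<in> map_vec n h ` H" by blast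
  next
    fix c x assume "c \<in> carrier S" "x \<in> map_vec n h ` H"
    moreover from this surj obtain r a where
      ra: "r \<in> carrier R" "c = h r" "a \<in> H" "x = map_vec n h a" by blast
    then have "r \<odot>\<^bsub>free_module R n\<^esub> a \<in> H"
      using H unfolding R_iff by blast
    moreover have "a \<in> carrier (free_module R n)" using ra sub by blast
    then have "c \<odot>\<^bsub>free_module S n\<^esub> x = map_vec n h (r \<odot>\<^bsub>free_module R n\<^esub> a)"
      using ra by (simp add: PiE_iff cong: restrict_cong)
    ultimately show "c \<odot>\<^bsub>free_module S n\<^esub> x \<in> map_vec n h ` H" by blast
  qed
qed

text \<open>The images of generators generate: a submodule over \<open>S\<close> that contains them
  pulls back to a submodule over \<open>R\<close> that contains the generators, hence all relations
  of \<open>u\<close>, and these cover the relations of \<open>v\<close>.\<close>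

lemma fg_relations_map_vec:
  assumes u: "u \<in> {..<n} \<rightarrow> carrier R" and v: "v \<in> {..<n} \<rightarrow> carrier S"
    and into: "\<And>a. a \<in> relations R n u \<Longrightarrow> map_vec n h a \<in> relations S n v"
    and onto: "relations S n v \<subseteq> map_vec n h ` relations R n u"
    and fg: "fg_relations R n u"
  shows "fg_relations S n v"
proof -
  obtain Y where Y: "finite Y \<and> Y \<subseteq> relations R n u \<and>
      (\<forall>H. submodule H R (free_module R n) \<and> Y \<subseteq> H \<longrightarrow> relations R n u \<subseteq> H)"
    using fg unfolding fg_submodule_iff[OF R.submodule_relations[OF u]] by (rule exE)
  have "relations S n v \<subseteq> H" if H: "submodule H S (free_module S n)" "map_vec n h ` Y \<subseteq> H" for H
  proof -
    have "Y \<subseteq> {x \<in> carrier (free_module R n). map_vec n h x \<in> H}"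
      using Y H(2) by (auto simp: relations_def)
    then have "relations R n u \<subseteq> {x \<in> carrier (free_module R n). map_vec n h x \<in> H}"
      using Y submodule_vimage_map_vec[OF H(1)] by simp
    then show ?thesis using onto by auto
  qed
  moreover have "map_vec n h ` Y \<subseteq> relations S n v" using Y into by auto
  ultimately show ?thesis
    using Y unfolding fg_submodule_iff[OF S.submodule_relations[OF v]]
    by (intro exI[of _ "map_vec n h ` Y"]) simp
qed

text \<open>The kernel of \<open>h\<close> is the annihilator of \<open>e\<close>. If
  \<open>u\<close> lifts \<open>v\<close>, a vector over \<open>R\<close> maps to a relation of
  \<open>v\<close> exactly when it is a relation of \<open>e u\<close>, and the relations of
  \<open>e u\<close> are finitely generated over \<open>R\<close>.\<close>

lemma coherent_ring_image:
  assumes surj: "h ` carrier R = carrier S"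
    and e: "e \<in> carrier R" "\<And>x. x \<in> carrier R \<Longrightarrow> h x = \<zero>\<^bsub>S\<^esub> \<longleftrightarrow> e \<otimes> x = \<zero>"
    and R: "coherent_ring R"
  shows "coherent_ring S"
  unfolding S.coherent_ring_iff_fg_relations
proof (intro allI ballI)
  fix n :: nat and v assume v: "v \<in> {..<n} \<rightarrow> carrier S"
  have "\<forall>i\<in>{..<n}. \<exists>x\<in>carrier R. v i = h x"
    using v surj by blast
  from Pi_choice[OF this] obtain u where
    u: "u \<in> {..<n} \<rightarrow> carrier R" "\<forall>i\<in>{..<n}. v i = h (u i)" ..
  let ?u = "\<lambda>i. e \<otimes> u i"
  have eu: "?u \<in> {..<n} \<rightarrow> carrier R" using u(1) e(1) by auto
  note dot_eu = R.dot_smult[OF u(1) e(1)]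
  have dot_v: "S.dot n v (map_vec n h a) = h (R.dot n u a)" if "a \<in> carrier (free_module R n)" for a
  proof -
    have "S.dot n v (map_vec n h a) = S.dot n (\<lambda>i. h (u i)) (map_vec n h a)"
      unfolding S.dot_eq using u that by (intro S.finsum_cong') (auto simp: PiE_iff Pi_iff)
    then show ?thesis using dot_map_vec[OF u(1) that] by simp
  qed
  have rel_iff: "map_vec n h a \<in> relations S n v \<longleftrightarrow> a \<in> relations R n ?u"
    if a: "a \<in> carrier (free_module R n)" for a
    using dot_eu[OF a] dot_v[OF a] e(2)[of "R.dot n u a"] module_homD(1)[OF R.dot_hom[OF u(1)] a]
      map_vec_closed[OF a] a
    by (simp add: R.relations_eq S.relations_eq del: free_module_simps)
  show "fg_relations S n v"
  proof (rule fg_relations_map_vec[OF eu v])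
    show "map_vec n h a \<in> relations S n v" if "a \<in> relations R n ?u" for a
      using rel_iff that by (simp add: R.relations_eq)
    show "relations S n v \<subseteq> map_vec n h ` relations R n ?u"
    proof
      fix b assume b: "b \<in> relations S n v"
      then have "\<forall>i\<in>{..<n}. \<exists>x\<in>carrier R. b i = h x"
        using surj by (fastforce simp: S.relations_eq)
      from Pi_choice[OF this] obtain a where
        a: "a \<in> {..<n} \<rightarrow> carrier R" "\<forall>i\<in>{..<n}. b i = h (a i)" ..
      let ?a = "restrict a {..<n}"
      have a': "?a \<in> carrier (free_module R n)" using a(1) by auto
      moreover have "b = map_vec n h ?a"
        using a b by (auto simp: S.relations_eq PiE_iff extensional_def fun_eq_iff)
      ultimately show "b \<in> map_vec n h ` relations R n ?u"
        using rel_iff[OF a'] b by blast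
    qed
    show "fg_relations R n ?u"
      using R eu unfolding R.coherent_ring_iff_fg_relations by blast
  qed
qed

end

section \<open>Overrings and unimodular vectors\<close>

text \<open>The two rings are separate records with equal operations, so that results about vectors
  apply to each of them unchanged; they may also coincide.\<close>

locale overring = R: cring R + T: cring T
  for R :: "('a, 'r) ring_scheme" (structure) and T :: "('a, 't) ring_scheme" (structure) +
  assumes carrier_subset: "carrier R \<subseteq> carrier T"
    and mult_eq: "monoid.mult R = monoid.mult T" and add_eq: "add R = add T"
    and one_eq: "\<one>\<^bsub>R\<^esub> = \<one>\<^bsub>T\<^esub>" and zero_eq: "\<zero>\<^bsub>R\<^esub> = \<zero>\<^bsub>T\<^esub>"
begin

lemma finsum_eq:
  assumes "f \<in> J \<rightarrow> carrier R"
  shows "finsum R f J = finsum T f J"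
proof -
  interpret ring_hom_cring R T "\<lambda>x. x"
    using carrier_subset
    by unfold_locales (auto simp: ring_hom_def mult_eq add_eq one_eq)
  show ?thesis using hom_finsum[OF assms] by (simp add: o_def)
qed

text \<open>Multiplying \<open>d\<close> by the sum of all \<open>w j v j\<close>, which is one,
  writes it as the sum of the vectors \<open>v j (w j d)\<close>. Each \<open>w j d\<close> is again
  a relation of \<open>v\<close>, and its multiple by \<open>v j\<close> lies in the Koszul
  span.\<close>

lemma relation_in_koszul_span:
  assumes v: "v \<in> {..<n} \<rightarrow> carrier R" and w: "w \<in> {..<n} \<rightarrow> carrier T"
    and vw: "(\<Oplus>\<^bsub>T\<^esub>j\<in>{..<n}. w j \<otimes>\<^bsub>T\<^esub> v j) = \<one>\<^bsub>T\<^esub>"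
    and d: "d \<in> relations R n v"
    and wd: "\<And>j k. j < n \<Longrightarrow> k < n \<Longrightarrow> w j \<otimes>\<^bsub>T\<^esub> d k \<in> carrier R"
    and H: "submodule H R (free_module R n)"
      "\<And>j k. j < n \<Longrightarrow> k < n \<Longrightarrow> R.koszul n v j (R.unit_vec n k) \<in> H"
  shows "d \<in> H"
proof -
  let ?F = "free_module R n"
  \<comment> \<open>The product with \<open>w j\<close> is formed in \<open>T\<close>, but
    \<open>wd\<close> keeps its entries in \<open>R\<close>.\<close>
  define b where "b j = (\<lambda>k\<in>{..<n}. w j \<otimes>\<^bsub>T\<^esub> d k)" for j
  have b_closed: "b j \<in> {..<n} \<rightarrow>\<^sub>E carrier R" if "j < n" for j
    using wd[OF that] by (auto simp: b_def)
  have d_closed: "d \<in> {..<n} \<rightarrow>\<^sub>E carrier R" using d by (simp add: relations_def)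
  have T: "v i \<in> carrier T" "w i \<in> carrier T" "d i \<in> carrier T" if "i < n" for i
    using that v w d_closed carrier_subset by auto
  have "b j \<in> relations R n v" if j: "j < n" for j
  proof -
    have dv: "(\<Oplus>\<^bsub>T\<^esub>k\<in>{..<n}. d k \<otimes>\<^bsub>T\<^esub> v k) = \<zero>\<^bsub>T\<^esub>"
    proof -
      have "(\<Oplus>\<^bsub>R\<^esub>k\<in>{..<n}. d k \<otimes>\<^bsub>R\<^esub> v k) = (\<Oplus>\<^bsub>T\<^esub>k\<in>{..<n}. d k \<otimes>\<^bsub>R\<^esub> v k)"
        using v d_closed by (intro finsum_eq) auto
      then show ?thesis using d by (simp add: relations_def zero_eq mult_eq)
    qed
    have "(\<Oplus>\<^bsub>R\<^esub>k\<in>{..<n}. b j k \<otimes>\<^bsub>R\<^esub> v k) = (\<Oplus>\<^bsub>T\<^esub>k\<in>{..<n}. b j k \<otimes>\<^bsub>R\<^esub> v k)"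
      using v b_closed[OF j] by (intro finsum_eq) auto
    also have "\<dots> = (\<Oplus>\<^bsub>T\<^esub>k\<in>{..<n}. w j \<otimes>\<^bsub>T\<^esub> (d k \<otimes>\<^bsub>T\<^esub> v k))"
      using T T(2)[OF j] by (intro T.finsum_cong') (auto simp: b_def mult_eq T.m_assoc)
    also have "\<dots> = w j \<otimes>\<^bsub>T\<^esub> (\<Oplus>\<^bsub>T\<^esub>k\<in>{..<n}. d k \<otimes>\<^bsub>T\<^esub> v k)"
      using T T(2)[OF j] by (intro T.finsum_rdistr[symmetric]) auto
    also have "\<dots> = \<zero>\<^bsub>R\<^esub>"
      using T(2)[OF j] by (simp add: dv zero_eq)
    finally show ?thesis
      using b_closed[OF j] by (simp add: relations_def)
  qed
  then have vb: "v j \<odot>\<^bsub>?F\<^esub> b j \<in> H" if "j < n" for j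
    using R.smult_relation_in_koszul_span[OF v that _ H(1) H(2)[OF that]] that by blast
  then have sum: "(\<Oplus>\<^bsub>?F\<^esub>j\<in>{..<n}. v j \<odot>\<^bsub>?F\<^esub> b j) \<in> H" (is "?s \<in> H")
    by (intro module.submodule_finsum[OF R.module_free_module H(1)]) auto
  then have s: "?s \<in> {..<n} \<rightarrow>\<^sub>E carrier R"
    using H(1) unfolding module.submodule_iff[OF R.module_free_module] by auto
  have "?s = d"
  proof (rule PiE_ext[OF s d_closed])
    fix i assume i: "i \<in> {..<n}"
    have "?s i = (\<Oplus>\<^bsub>R\<^esub>j\<in>{..<n}. (v j \<odot>\<^bsub>?F\<^esub> b j) i)"
      using v b_closed i by (intro R.finsum_free_module) (auto simp: PiE_iff Pi_iff)
    also have "\<dots> = (\<Oplus>\<^bsub>T\<^esub>j\<in>{..<n}. (v j \<odot>\<^bsub>?F\<^esub> b j) i)"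
      using v b_closed i by (intro finsum_eq) (auto simp: PiE_iff Pi_iff)
    also have "\<dots> = (\<Oplus>\<^bsub>T\<^esub>j\<in>{..<n}. (w j \<otimes>\<^bsub>T\<^esub> v j) \<otimes>\<^bsub>T\<^esub> d i)"
      using T i by (intro T.finsum_cong') (auto simp: b_def mult_eq T.m_ac)
    also have "\<dots> = (\<Oplus>\<^bsub>T\<^esub>j\<in>{..<n}. w j \<otimes>\<^bsub>T\<^esub> v j) \<otimes>\<^bsub>T\<^esub> d i"
      using T i by (intro T.finsum_ldistr[symmetric]) auto
    also have "\<dots> = d i" using T(3) i by (simp add: vw)
    finally show "?s i = d i" .
  qed
  then show ?thesis using sum by simp
qed

end

text \<open>Both rings are taken to be \<open>R\<close>, so the products of \<open>w j\<close> with
  the entries of a relation lie in \<open>R\<close>, and the Koszul relations of the unit vectors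
  generate everything.\<close>

lemma (in cring) fg_relations_unimodular:
  assumes v: "v \<in> {..<n} \<rightarrow> carrier R" and w: "w \<in> {..<n} \<rightarrow> carrier R"
    and vw: "(\<Oplus>j\<in>{..<n}. w j \<otimes> v j) = \<one>"
  shows "fg_relations R n v"
proof -
  interpret overring R R by unfold_locales auto
  let ?K = "(\<lambda>(j, k). koszul n v j (unit_vec n k)) ` ({..<n} \<times> {..<n})"
  have K: "?K \<subseteq> relations R n v"
    using koszul_relations[OF v] by auto
  have "relations R n v \<subseteq> H" if H: "submodule H R (free_module R n)" "?K \<subseteq> H" for H
  proof
    fix d assume d: "d \<in> relations R n v"
    show "d \<in> H"
    proof (rule relation_in_koszul_span[OF v w vw d _ H(1)])
      fix j k assume jk: "j < n" "k < n"
      show "w j \<otimes> d k \<in> carrier R" using jk w d by (auto simp: relations_def)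
      show "koszul n v j (unit_vec n k) \<in> H" using jk H(2) by auto
    qed
  qed
  then show ?thesis
    using K unfolding fg_submodule_iff[OF submodule_relations[OF v]]
    by (intro exI[of _ ?K]) simp
qed

section \<open>Relations over R and over R/C\<close>

text \<open>\<open>A\<close> is given by a surjection \<open>\<eta>\<close> with kernel
  \<open>C\<close>, so that arguments modulo \<open>C\<close> need no cosets.\<close>

locale conductor = overring R T + A: cring A
  for R :: "('a, 'r) ring_scheme" (structure) and T :: "('a, 't) ring_scheme" (structure)
    and A :: "('b, 's) ring_scheme" (structure) +
  fixes C :: "'a set" and \<eta> :: "'a \<Rightarrow> 'b"
  assumes C_ideal: "ideal C T" and C_subset: "C \<subseteq> carrier R"
    and \<eta>_hom: "\<eta> \<in> ring_hom R A" and \<eta>_surj: "\<eta> ` carrier R = carrier A"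
    and \<eta>_kernel: "x \<in> carrier R \<Longrightarrow> \<eta> x = \<zero>\<^bsub>A\<^esub> \<longleftrightarrow> x \<in> C"
begin

lemma \<eta>_hom_cring: "ring_hom_cring R A \<eta>"
  by unfold_locales (rule \<eta>_hom)

lemma C_mult: "c \<in> C \<Longrightarrow> t \<in> carrier T \<Longrightarrow> c \<otimes>\<^bsub>T\<^esub> t \<in> C" "c \<in> C \<Longrightarrow> t \<in> carrier T \<Longrightarrow> t \<otimes>\<^bsub>T\<^esub> c \<in> C"
  using ideal.I_r_closed[OF C_ideal] ideal.I_l_closed[OF C_ideal] by auto

lemma lift_vec:
  assumes "b \<in> {..<n} \<rightarrow> carrier A"
  obtains a where "a \<in> carrier (free_module R n)" "\<forall>i\<in>{..<n}. b i = \<eta> (a i)"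
proof -
  have "\<forall>i\<in>{..<n}. \<exists>x\<in>carrier R. b i = \<eta> x"
    using assms \<eta>_surj by blast
  from Pi_choice[OF this] obtain a where
    a: "a \<in> {..<n} \<rightarrow> carrier R" "\<forall>i\<in>{..<n}. b i = \<eta> (a i)" ..
  then show ?thesis by (intro that[of "restrict a {..<n}"]) auto
qed

lemma dot_\<eta>:
  assumes "v \<in> {..<n} \<rightarrow> carrier R" "a \<in> carrier (free_module R n)"
  shows "A.dot n (\<lambda>i. \<eta> (v i)) (map_vec n \<eta> a) = \<eta> (R.dot n v a)"
  by (rule ring_hom_cring.dot_map_vec[OF \<eta>_hom_cring assms])

text \<open>A lift \<open>a\<close> of a relation over \<open>A\<close> has its dot product with
  \<open>v\<close> in \<open>C\<close>. Subtracting this element times \<open>w\<close> turns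
  \<open>a\<close> into a relation over \<open>R\<close> and does not change it modulo
  \<open>C\<close>, because \<open>C\<close> absorbs multiplication by \<open>T\<close>.\<close>

lemma relations_quotient:
  assumes v: "v \<in> {..<n} \<rightarrow> carrier R" and w: "w \<in> {..<n} \<rightarrow> carrier T"
    and vw: "(\<Oplus>\<^bsub>T\<^esub>j\<in>{..<n}. w j \<otimes>\<^bsub>T\<^esub> v j) = \<one>\<^bsub>T\<^esub>"
  shows "relations A n (\<lambda>i. \<eta> (v i)) = map_vec n \<eta> ` relations R n v"
proof
  note \<eta> = ring_hom_closed[OF \<eta>_hom] ring_hom_add[OF \<eta>_hom]
  have \<eta>0: "\<eta> \<zero>\<^bsub>R\<^esub> = \<zero>\<^bsub>A\<^esub>"
    using \<eta>_kernel[OF R.zero_closed] additive_subgroup.zero_closed[OF ideal.axioms(1)[OF C_ideal]] zero_eq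
    by simp
  show "map_vec n \<eta> ` relations R n v \<subseteq> relations A n (\<lambda>i. \<eta> (v i))"
  proof
    fix b assume "b \<in> map_vec n \<eta> ` relations R n v"
    then obtain a where a: "a \<in> carrier (free_module R n)" "R.dot n v a = \<zero>\<^bsub>R\<^esub>" "b = map_vec n \<eta> a"
      by (auto simp: R.relations_eq)
    have "map_vec n \<eta> a \<in> carrier (free_module A n)" using a(1) \<eta>(1) by auto
    then show "b \<in> relations A n (\<lambda>i. \<eta> (v i))"
      using dot_\<eta>[OF v a(1)] a(2,3) \<eta>0 by (simp add: A.relations_eq)
  qed
  show "relations A n (\<lambda>i. \<eta> (v i)) \<subseteq> map_vec n \<eta> ` relations R n v"
  proof
    fix b assume b: "b \<in> relations A n (\<lambda>i. \<eta> (v i))"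
    then have b': "b \<in> {..<n} \<rightarrow>\<^sub>E carrier A" "A.dot n (\<lambda>i. \<eta> (v i)) b = \<zero>\<^bsub>A\<^esub>"
      by (simp_all add: A.relations_eq)
    obtain a where a: "a \<in> carrier (free_module R n)" "\<forall>i\<in>{..<n}. b i = \<eta> (a i)"
      using lift_vec[of b n] b'(1) by auto
    have ba: "b = map_vec n \<eta> a"
      using a b'(1) by (auto simp: PiE_iff extensional_def fun_eq_iff)
    define d where "d = \<ominus>\<^bsub>R\<^esub> R.dot n v a"
    have dot_a: "R.dot n v a \<in> carrier R"
      using module_homD(1)[OF R.dot_hom[OF v] a(1)] by simp
    then have d: "d \<in> carrier R" by (simp add: d_def)
    have "\<eta> (R.dot n v a) = \<zero>\<^bsub>A\<^esub>"
      using dot_\<eta>[OF v a(1)] b'(2) ba by simp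
    then have "\<eta> d = \<zero>\<^bsub>A\<^esub>"
      using \<eta>(2)[OF dot_a d] \<eta>(1)[OF d] \<eta>0 dot_a by (simp add: d_def R.r_neg)
    then have dC: "d \<in> C" using \<eta>_kernel[OF d] by simp
    \<comment> \<open>The entries of \<open>w\<close> lie only in \<open>T\<close>; multiplication
      by \<open>d\<close>, an element of \<open>C\<close>, brings them into \<open>C\<close> and
      hence into \<open>R\<close>.\<close>
    define e where "e = (\<lambda>i\<in>{..<n}. d \<otimes>\<^bsub>T\<^esub> w i)"
    have eC: "e i \<in> C" if "i < n" for i
      using that C_mult(1)[OF dC] w by (auto simp: e_def)
    then have e: "e \<in> carrier (free_module R n)" using C_subset by (auto simp: e_def)
    have wvT: "w i \<in> carrier T" "v i \<in> carrier T" if "i < n" for i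
      using that v w carrier_subset by auto
    have dT: "d \<in> carrier T" using d carrier_subset by auto
    have "R.dot n v e = (\<Oplus>\<^bsub>T\<^esub>i\<in>{..<n}. e i \<otimes>\<^bsub>R\<^esub> v i)"
      unfolding R.dot_eq using v e by (intro finsum_eq) auto
    also have "\<dots> = (\<Oplus>\<^bsub>T\<^esub>i\<in>{..<n}. d \<otimes>\<^bsub>T\<^esub> (w i \<otimes>\<^bsub>T\<^esub> v i))"
      using wvT dT by (intro T.finsum_cong') (auto simp: e_def mult_eq T.m_assoc)
    also have "\<dots> = d \<otimes>\<^bsub>T\<^esub> \<one>\<^bsub>T\<^esub>"
      unfolding vw[symmetric] using wvT dT by (intro T.finsum_rdistr[symmetric]) auto
    finally have dot_e: "R.dot n v e = d" using dT by simp
    let ?x = "a \<oplus>\<^bsub>free_module R n\<^esub> e"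
    have "?x \<in> carrier (free_module R n)"
      using a(1) e by auto
    moreover have "R.dot n v ?x = \<zero>\<^bsub>R\<^esub>"
      using module_homD(2)[OF R.dot_hom[OF v] a(1) e] dot_e dot_a by (simp add: d_def R.r_neg)
    ultimately have "?x \<in> relations R n v" unfolding R.relations_eq by blast
    moreover have "\<eta> (a i \<oplus>\<^bsub>R\<^esub> e i) = \<eta> (a i)" if "i < n" for i
    proof -
      have "a i \<in> carrier R" "e i \<in> carrier R" using a(1) e that by auto
      then show ?thesis using \<eta> \<eta>_kernel[of "e i"] eC[OF that] by simp
    qed
    then have "b = map_vec n \<eta> ?x"
      unfolding ba by (simp cong: restrict_cong)
    ultimately show "b \<in> map_vec n \<eta> ` relations R n v" by blast
  qed
qed

text \<open>Lifts of generators over \<open>A\<close> account for a relation over \<open>R\<close>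
  up to one with entries in \<open>C\<close>. The latter is a combination of Koszul relations,
  because its products with the \<open>w j\<close> stay in \<open>C\<close>. Conversely, generators
  over \<open>R\<close> map to generators over \<open>A\<close>.\<close>

lemma fg_relations_quotient:
  assumes v: "v \<in> {..<n} \<rightarrow> carrier R" and w: "w \<in> {..<n} \<rightarrow> carrier T"
    and vw: "(\<Oplus>\<^bsub>T\<^esub>j\<in>{..<n}. w j \<otimes>\<^bsub>T\<^esub> v j) = \<one>\<^bsub>T\<^esub>"
  shows "fg_relations A n (\<lambda>i. \<eta> (v i)) \<longleftrightarrow> fg_relations R n v"
proof
  note \<eta> = ring_hom_closed[OF \<eta>_hom] ring_hom_add[OF \<eta>_hom]
  note rel = relations_quotient[OF assms]
  have \<eta>v: "(\<lambda>i. \<eta> (v i)) \<in> {..<n} \<rightarrow> carrier A" using v \<eta>(1) by auto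
  show "fg_relations A n (\<lambda>i. \<eta> (v i))" if "fg_relations R n v"
    using ring_hom_cring.fg_relations_map_vec[OF \<eta>_hom_cring v \<eta>v _ _ that] rel by auto
  assume "fg_relations A n (\<lambda>i. \<eta> (v i))"
  then obtain Z where Z: "finite Z \<and> Z \<subseteq> relations A n (\<lambda>i. \<eta> (v i)) \<and>
      (\<forall>H. submodule H A (free_module A n) \<and> Z \<subseteq> H \<longrightarrow> relations A n (\<lambda>i. \<eta> (v i)) \<subseteq> H)"
    unfolding fg_submodule_iff[OF A.submodule_relations[OF \<eta>v]] by (rule exE)
  then obtain Y where Y: "Y \<subseteq> relations R n v" "finite Y" "Z = map_vec n \<eta> ` Y"
    unfolding rel using finite_subset_image[of Z "map_vec n \<eta>" "relations R n v"] by auto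
  let ?K = "(\<lambda>(j, k). R.koszul n v j (R.unit_vec n k)) ` ({..<n} \<times> {..<n})"
  have K: "?K \<subseteq> relations R n v"
    using R.koszul_relations[OF v] by auto
  note R_iff = module.submodule_iff[OF R.module_free_module]
  have "relations R n v \<subseteq> H" if H: "submodule H R (free_module R n)" "Y \<union> ?K \<subseteq> H" for H
  proof
    fix k assume k: "k \<in> relations R n v"
    \<comment> \<open>Intersecting with the relations ensures that the lift \<open>h\<close> found
      below is itself a relation, and with it the difference \<open>d\<close> of \<open>k\<close>
      and \<open>h\<close>.\<close>
    have sub: "submodule (H \<inter> relations R n v) R (free_module R n)"
      using H(1) R.submodule_relations[OF v] unfolding R_iff by auto
    have "Z \<subseteq> map_vec n \<eta> ` (H \<inter> relations R n v)"
      using Y H(2) by auto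
    then have "relations A n (\<lambda>i. \<eta> (v i)) \<subseteq> map_vec n \<eta> ` (H \<inter> relations R n v)"
      using Z ring_hom_cring.submodule_image_map_vec[OF \<eta>_hom_cring \<eta>_surj sub] by simp
    then have "map_vec n \<eta> k \<in> map_vec n \<eta> ` (H \<inter> relations R n v)"
      unfolding rel using k by auto
    then obtain h where h: "h \<in> H" "h \<in> relations R n v" "map_vec n \<eta> k = map_vec n \<eta> h"
      by auto
    let ?h = "(\<ominus>\<^bsub>R\<^esub> \<one>\<^bsub>R\<^esub>) \<odot>\<^bsub>free_module R n\<^esub> h"
    define d where "d = k \<oplus>\<^bsub>free_module R n\<^esub> ?h"
    have "?h \<in> relations R n v"
      using R.submodule_relations[OF v] h(2) unfolding R_iff by (simp del: free_module_simps)
    then have d: "d \<in> relations R n v"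
      using R.submodule_relations[OF v] k unfolding R_iff d_def by (simp del: free_module_simps)
    have kh: "k i \<in> carrier R" "h i \<in> carrier R" if "i < n" for i
      using that k h(2) by (auto simp: relations_def)
    have di: "d i = k i \<ominus>\<^bsub>R\<^esub> h i" if "i < n" for i
      using kh[OF that] that by (simp add: d_def R.l_minus R.minus_eq)
    have dC: "d i \<in> C" if i: "i < n" for i
    proof -
      have "\<eta> (k i) = \<eta> (h i)" using fun_cong[OF h(3), of i] i by simp
      moreover have "\<eta> (d i) \<oplus>\<^bsub>A\<^esub> \<eta> (h i) = \<eta> (k i)"
        using kh[OF i] \<eta>(2)[of "d i" "h i"]
        by (simp add: di[OF i] R.minus_eq R.a_assoc R.l_neg)
      ultimately have "\<eta> (d i) = \<zero>\<^bsub>A\<^esub>"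
        using \<eta>(1) kh[OF i] di[OF i] by simp
      then show ?thesis using \<eta>_kernel[of "d i"] kh[OF i] di[OF i] by simp
    qed
    have "d \<in> H"
    proof (rule relation_in_koszul_span[OF v w vw d _ H(1)])
      fix j l assume jl: "j < n" "l < n"
      show "w j \<otimes>\<^bsub>T\<^esub> d l \<in> carrier R" using jl C_mult(2)[OF dC] w C_subset by auto
      show "R.koszul n v j (R.unit_vec n l) \<in> H" using jl H(2) by auto
    qed
    then have "d \<oplus>\<^bsub>free_module R n\<^esub> h \<in> H"
      using H(1) h(1) unfolding R_iff by (simp del: free_module_simps)
    moreover have "d \<oplus>\<^bsub>free_module R n\<^esub> h = k"
    proof (rule PiE_ext[of _ "{..<n}" "\<lambda>_. carrier R"])
      show "d \<oplus>\<^bsub>free_module R n\<^esub> h \<in> {..<n} \<rightarrow>\<^sub>E carrier R"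
        using kh by (auto simp: di)
      show "k \<in> {..<n} \<rightarrow>\<^sub>E carrier R" using k by (simp add: relations_def)
      fix i assume "i \<in> {..<n}"
      then show "(d \<oplus>\<^bsub>free_module R n\<^esub> h) i = k i"
        using kh[of i] by (simp add: di R.minus_eq R.a_assoc R.l_neg)
    qed
    ultimately show "k \<in> H" by simp
  qed
  then show "fg_relations R n v"
    using Y K unfolding fg_submodule_iff[OF R.submodule_relations[OF v]]
    by (intro exI[of _ "Y \<union> ?K"]) simp
qed

text \<open>
  The element \<open>s\<close> is regular on all of \<open>T\<close>, and not only on \<open>U\<close>, because \<open>C = CUT = CU\<close> is contained
  in \<open>U\<close>.
\<close>

lemma unimodular_multiple:
  assumes c: "c \<in> C" "\<And>t. t \<in> carrier T \<Longrightarrow> c \<otimes>\<^bsub>T\<^esub> t = \<zero>\<^bsub>T\<^esub> \<Longrightarrow> t = \<zero>\<^bsub>T\<^esub>"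
    and u: "u \<in> {..<n::nat} \<rightarrow> carrier R"
    and r: "r \<in> carrier R" and s: "s \<in> carrier R" and U: "ideal U R"
    and UT: "Idl\<^bsub>T\<^esub> U = carrier T" and rT: "PIdl\<^bsub>T\<^esub> r = carrier T"
    and rs: "r <#\<^bsub>T\<^esub> (Idl\<^bsub>R\<^esub> (u ` {..<n})) = s <#\<^bsub>T\<^esub> U"
    and inj: "inj_on (\<lambda>x. s \<otimes>\<^bsub>T\<^esub> x) U"
  shows "\<exists>v \<in> {..<n} \<rightarrow> carrier R. \<exists>w \<in> {..<n} \<rightarrow> carrier T.
    (\<Oplus>\<^bsub>T\<^esub>j\<in>{..<n}. w j \<otimes>\<^bsub>T\<^esub> v j) = \<one>\<^bsub>T\<^esub> \<and> (\<forall>i<n. r \<otimes>\<^bsub>T\<^esub> u i = s \<otimes>\<^bsub>T\<^esub> v i) \<and>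
    (\<forall>t\<in>carrier T. s \<otimes>\<^bsub>T\<^esub> t = \<zero>\<^bsub>T\<^esub> \<longrightarrow> t = \<zero>\<^bsub>T\<^esub>) \<and> (\<exists>q\<in>carrier T. q \<otimes>\<^bsub>T\<^esub> r = \<one>\<^bsub>T\<^esub>)"
proof -
  let ?I = "Idl\<^bsub>R\<^esub> (u ` {..<n})"
  have U_sub: "U \<subseteq> carrier R" using ideal.Icarr[OF U] by blast
  have u_sub: "u ` {..<n} \<subseteq> carrier R" using u by auto
  have "\<forall>i\<in>{..<n}. \<exists>y\<in>U. r \<otimes>\<^bsub>T\<^esub> u i = s \<otimes>\<^bsub>T\<^esub> y"
  proof
    fix i assume "i \<in> {..<n}"
    then have "u i \<in> ?I" using R.genideal_self[OF u_sub] by auto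
    then have "r \<otimes>\<^bsub>T\<^esub> u i \<in> s <#\<^bsub>T\<^esub> U" unfolding rs[symmetric] by (auto simp: l_coset_def)
    then show "\<exists>y\<in>U. r \<otimes>\<^bsub>T\<^esub> u i = s \<otimes>\<^bsub>T\<^esub> y" by (auto simp: l_coset_def)
  qed
  \<comment> \<open>The \<open>v i\<close> are elements of \<open>U\<close> that correspond to the
    \<open>u i\<close> under the equality \<open>rI = sU\<close>.\<close>
  from Pi_choice[OF this] obtain v where
    v: "v \<in> {..<n} \<rightarrow> U" "\<forall>i\<in>{..<n}. r \<otimes>\<^bsub>T\<^esub> u i = s \<otimes>\<^bsub>T\<^esub> v i" ..
  have vR: "v \<in> {..<n} \<rightarrow> carrier R" using v(1) U_sub by auto
  then have vT: "v \<in> {..<n} \<rightarrow> carrier T" using carrier_subset by auto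
  have dot_eq_T: "R.dot n v a = T.dot n v a" if "a \<in> carrier (free_module R n)" for a
    unfolding R.dot_eq T.dot_eq mult_eq[symmetric] using vR that by (intro finsum_eq) auto
  \<comment> \<open>For \<open>y\<close> in \<open>U\<close>, write \<open>s y\<close> as
    \<open>r\<close> times a combination of the \<open>u i\<close>, replace each
    \<open>r u i\<close> by \<open>s v i\<close>, and cancel \<open>s\<close>, which is injective on
    \<open>U\<close>. Since \<open>U\<close> generates the unit ideal of \<open>T\<close>, so does
    \<open>v\<close>.\<close>
  have "U \<subseteq> Idl\<^bsub>T\<^esub> (v ` {..<n})"
  proof
    fix y assume y: "y \<in> U"
    then have "s \<otimes>\<^bsub>T\<^esub> y \<in> r <#\<^bsub>T\<^esub> ?I" unfolding rs by (auto simp: l_coset_def)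
    then obtain a where a: "a \<in> carrier (free_module R n)" "s \<otimes>\<^bsub>T\<^esub> y = r \<otimes>\<^bsub>T\<^esub> R.dot n u a"
      using R.genideal_image[OF u] by (auto simp: l_coset_def)
    have "r \<otimes>\<^bsub>R\<^esub> R.dot n u a = R.dot n (\<lambda>i. r \<otimes>\<^bsub>R\<^esub> u i) a"
      by (rule R.dot_smult[OF u r a(1), symmetric])
    also have "\<dots> = R.dot n (\<lambda>i. s \<otimes>\<^bsub>R\<^esub> v i) a"
      unfolding R.dot_eq using a(1) v(2) s vR by (intro R.finsum_cong') (auto simp: mult_eq[symmetric] PiE_iff Pi_iff)
    also have "\<dots> = s \<otimes>\<^bsub>R\<^esub> R.dot n v a"
      by (rule R.dot_smult[OF vR s a(1)])
    finally have "s \<otimes>\<^bsub>T\<^esub> y = s \<otimes>\<^bsub>T\<^esub> R.dot n v a" using a(2) by (simp add: mult_eq)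
    moreover have "R.dot n v a \<in> U" using R.dot_in_ideal[OF U v(1)] a(1) by simp
    ultimately have "y = T.dot n v a" using inj y dot_eq_T[OF a(1)] by (simp add: inj_on_def)
    moreover have "a \<in> {..<n} \<rightarrow>\<^sub>E carrier T" using a(1) carrier_subset by (auto simp: PiE_iff)
    ultimately show "y \<in> Idl\<^bsub>T\<^esub> (v ` {..<n})" unfolding T.genideal_image[OF vT] by blast
  qed
  moreover have "ideal (Idl\<^bsub>T\<^esub> (v ` {..<n})) T" using vT by (intro T.genideal_ideal) auto
  ultimately have "carrier T \<subseteq> Idl\<^bsub>T\<^esub> (v ` {..<n})"
    using T.genideal_minimal UT by metis
  then have "\<one>\<^bsub>T\<^esub> \<in> T.dot n v ` ({..<n} \<rightarrow>\<^sub>E carrier T)"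
    using T.genideal_image[OF vT] by auto
  then obtain w where w: "w \<in> {..<n} \<rightarrow>\<^sub>E carrier T" "T.dot n v w = \<one>\<^bsub>T\<^esub>" by auto
  have sT: "s \<in> carrier T" using s carrier_subset by auto
  have cT: "c \<in> carrier T" using c(1) C_subset carrier_subset by auto
  have s_reg: "t = \<zero>\<^bsub>T\<^esub>" if t: "t \<in> carrier T" "s \<otimes>\<^bsub>T\<^esub> t = \<zero>\<^bsub>T\<^esub>" for t
  proof -
    \<comment> \<open>The element \<open>t\<close> need not lie in \<open>U\<close>, but
      \<open>c t\<close> does: it is the combination of the \<open>v i\<close> with coefficients
      \<open>c t w i\<close> from \<open>C\<close>. Injectivity on \<open>U\<close> then gives
      \<open>c t = 0\<close>, and \<open>c\<close> is regular.\<close>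
    let ?ct = "c \<otimes>\<^bsub>T\<^esub> t"
    let ?a = "\<lambda>i\<in>{..<n}. ?ct \<otimes>\<^bsub>T\<^esub> w i"
    have ct: "?ct \<in> C" using C_mult(1)[OF c(1) t(1)] .
    have ctT: "?ct \<in> carrier T" using cT t(1) by simp
    have a: "?a \<in> carrier (free_module R n)"
      using C_mult(1)[OF ct] w(1) C_subset by auto
    have wi: "w i \<in> carrier T" "v i \<in> carrier T" if "i < n" for i using that w(1) vT by auto
    have "R.dot n v ?a = (\<Oplus>\<^bsub>T\<^esub>i\<in>{..<n}. ?ct \<otimes>\<^bsub>T\<^esub> (w i \<otimes>\<^bsub>T\<^esub> v i))"
      unfolding dot_eq_T[OF a] T.dot_eq using wi ctT
      by (intro T.finsum_cong') (auto simp: T.m_assoc simp del: T.m_closed intro!: T.m_closed)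
    also have "\<dots> = ?ct \<otimes>\<^bsub>T\<^esub> T.dot n v w"
      unfolding T.dot_eq using wi ctT by (intro T.finsum_rdistr[symmetric]) auto
    finally have "R.dot n v ?a = ?ct" using w(2) ctT by simp
    then have "?ct \<in> U" using R.dot_in_ideal[OF U v(1), of ?a] a by simp
    moreover have "\<zero>\<^bsub>T\<^esub> \<in> U"
      using additive_subgroup.zero_closed[OF ideal.axioms(1)[OF U]] zero_eq by simp
    moreover have "s \<otimes>\<^bsub>T\<^esub> ?ct = s \<otimes>\<^bsub>T\<^esub> \<zero>\<^bsub>T\<^esub>"
      using sT cT t by (simp add: T.m_lcomm[of s c t])
    ultimately have "?ct = \<zero>\<^bsub>T\<^esub>" using inj by (simp add: inj_on_def)
    then show ?thesis using c(2) t(1) by simp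
  qed
  have "\<one>\<^bsub>T\<^esub> \<in> PIdl\<^bsub>T\<^esub> r" unfolding rT by simp
  then have "\<exists>q\<in>carrier T. q \<otimes>\<^bsub>T\<^esub> r = \<one>\<^bsub>T\<^esub>" by (auto simp: cgenideal_def)
  moreover have "w \<in> {..<n} \<rightarrow> carrier T" "(\<Oplus>\<^bsub>T\<^esub>j\<in>{..<n}. w j \<otimes>\<^bsub>T\<^esub> v j) = \<one>\<^bsub>T\<^esub>"
    using w by (auto simp: T.dot_eq)
  ultimately show ?thesis
    using vR v(2) s_reg by (intro bexI[of _ v] bexI[of _ w]) auto
qed

end

section \<open>Products of integral domains\<close>

text \<open>The coordinates of \<open>x\<close> are the values \<open>h x l\<close>. The isomorphism
  is used coordinatewise: \<open>eqI\<close> compares elements, and \<open>realize\<close> produces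
  an element with prescribed coordinates.\<close>

locale domain_product = A: cring A for A :: "('a, 'r) ring_scheme" (structure) +
  fixes L :: "'l set" and D :: "'l \<Rightarrow> ('b, 'd) ring_scheme" and h :: "'a \<Rightarrow> 'l \<Rightarrow> 'b"
  assumes dom: "l \<in> L \<Longrightarrow> domain (D l)" and iso: "h \<in> ring_iso A (product_ring L D)"
begin

lemma proj_hom: "l \<in> L \<Longrightarrow> ring_hom_cring A (D l) (\<lambda>x. h x l)"
proof -
  assume l: "l \<in> L"
  then have "cring (D l)" using dom by (simp add: domain.axioms(1))
  moreover have "(\<lambda>x. h x l) \<in> ring_hom A (D l)"
    using iso l by (auto simp: ring_iso_def ring_hom_def product_ring_def)
  ultimately show ?thesis
    by (intro ring_hom_cring.intro ring_hom_cring_axioms.intro A.is_cring)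
qed

lemma eqI:
  assumes "x \<in> carrier A" "y \<in> carrier A" "\<And>l. l \<in> L \<Longrightarrow> h x l = h y l"
  shows "x = y"
proof -
  have bij: "bij_betw h (carrier A) (\<Pi>\<^sub>E l\<in>L. carrier (D l))"
    using iso by (simp add: ring_iso_def product_ring_def)
  have "h x \<in> (\<Pi>\<^sub>E l\<in>L. carrier (D l))" "h y \<in> (\<Pi>\<^sub>E l\<in>L. carrier (D l))"
    using bij assms(1,2) by (auto simp: bij_betw_def)
  then have "h x = h y" using assms(3) by (rule PiE_ext)
  then show ?thesis using bij assms(1,2) by (auto simp: bij_betw_def inj_on_def)
qed

lemma realize:
  assumes "\<And>l. l \<in> L \<Longrightarrow> f l \<in> carrier (D l)"
  shows "\<exists>x\<in>carrier A. \<forall>l\<in>L. h x l = f l"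
proof -
  have "restrict f L \<in> h ` carrier A"
    using iso assms by (auto simp: ring_iso_def product_ring_def bij_betw_def)
  then obtain x where "x \<in> carrier A" "h x = restrict f L" by auto
  then show ?thesis by (intro bexI[of _ x]) auto
qed

text \<open>Take \<open>e\<close> to be the indicator of the coordinates at which \<open>s\<close>
  vanishes. In a domain, \<open>s x = 0\<close> forces \<open>x\<close> to vanish at all the other
  coordinates.\<close>

lemma annihilator_idempotent:
  assumes s: "s \<in> carrier A"
  shows "\<exists>e\<in>carrier A. e \<otimes> s = \<zero> \<and> (\<forall>x\<in>carrier A. s \<otimes> x = \<zero> \<longrightarrow> e \<otimes> x = x)"
proof -
  let ?f = "\<lambda>l. if h s l = \<zero>\<^bsub>D l\<^esub> then \<one>\<^bsub>D l\<^esub> else \<zero>\<^bsub>D l\<^esub>"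
  have D: "ring (D l)" if "l \<in> L" for l
    using dom[OF that] by (simp add: domain.axioms cring.axioms)
  have "?f l \<in> carrier (D l)" if "l \<in> L" for l
    using ring.ring_simprules(2,6)[OF D[OF that]] by simp
  then obtain e where e: "e \<in> carrier A" "\<forall>l\<in>L. h e l = ?f l"
    using realize[of ?f] by blast
  have "e \<otimes> s = \<zero>"
  proof (rule eqI)
    fix l assume l: "l \<in> L"
    interpret ring_hom_cring A "D l" "\<lambda>x. h x l" by (rule proj_hom[OF l])
    show "h (e \<otimes> s) l = h \<zero> l" using e s l by simp
  qed (use e s in auto)
  moreover have "e \<otimes> x = x" if x: "x \<in> carrier A" "s \<otimes> x = \<zero>" for x
  proof (rule eqI)
    fix l assume l: "l \<in> L"
    interpret ring_hom_cring A "D l" "\<lambda>x. h x l" by (rule proj_hom[OF l])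
    have "h s l \<otimes>\<^bsub>D l\<^esub> h x l = \<zero>\<^bsub>D l\<^esub>" using x s hom_mult[of s x] by simp
    then have "h s l = \<zero>\<^bsub>D l\<^esub> \<or> h x l = \<zero>\<^bsub>D l\<^esub>"
      using domain.integral[OF dom[OF l]] x s by simp
    then show "h (e \<otimes> x) l = h x l" using e x l by auto
  qed (use e x in auto)
  ultimately show ?thesis using e(1) by blast
qed

text \<open>The annihilator of the indicator \<open>e\<close> of the coordinate \<open>l\<close> is
  the kernel of the projection to \<open>D l\<close>, so \<open>coherent_ring_image\<close>
  applies.\<close>

lemma coherent_ring_factor:
  assumes A: "coherent_ring A" and l: "l \<in> L"
  shows "coherent_ring (D l)"
proof -
  interpret ring_hom_cring A "D l" "\<lambda>x. h x l" by (rule proj_hom[OF l])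
  have ring: "ring (D k)" if "k \<in> L" for k
    using dom[OF that] by (simp add: domain.axioms cring.axioms)
  have ex: "\<exists>x\<in>carrier A. \<forall>k\<in>L. h x k = (if k = l then c else \<zero>\<^bsub>D k\<^esub>)" if "c \<in> carrier (D l)" for c
    using that ring.ring_simprules(2)[OF ring] by (intro realize) auto
  obtain e where e: "e \<in> carrier A" "\<forall>k\<in>L. h e k = (if k = l then \<one>\<^bsub>D l\<^esub> else \<zero>\<^bsub>D k\<^esub>)"
    using ex[OF S.one_closed] by blast
  show ?thesis
  proof (rule coherent_ring_image[OF _ e(1) _ A])
    show "(\<lambda>x. h x l) ` carrier A = carrier (D l)"
    proof
      show "carrier (D l) \<subseteq> (\<lambda>x. h x l) ` carrier A"
      proof
        fix c assume "c \<in> carrier (D l)"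
        from ex[OF this] l show "c \<in> (\<lambda>x. h x l) ` carrier A" by force
      qed
    qed auto
    fix x assume x: "x \<in> carrier A"
    have ex_l: "h (e \<otimes> x) l = h x l" using e x l by simp
    show "h x l = \<zero>\<^bsub>D l\<^esub> \<longleftrightarrow> e \<otimes> x = \<zero>"
    proof
      assume hx: "h x l = \<zero>\<^bsub>D l\<^esub>"
      show "e \<otimes> x = \<zero>"
      proof (rule eqI)
        fix k assume k: "k \<in> L"
        interpret K: ring_hom_cring A "D k" "\<lambda>x. h x k" by (rule proj_hom[OF k])
        show "h (e \<otimes> x) k = h \<zero> k"
          using e x k hx ex_l by (cases "k = l") auto
      qed (use e x in auto)
    qed (use ex_l in simp)
  qed
qed

end

text \<open>The annihilator of \<open>s\<close> is generated by \<open>e\<close>. A relation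
  \<open>a\<close> of \<open>s v\<close> splits into \<open>a - e a\<close>, a relation of
  \<open>v\<close>, and \<open>e a\<close>, a combination of the multiples of unit vectors by
  \<open>e\<close>.\<close>

lemma (in cring) fg_relations_smult:
  assumes v: "v \<in> {..<n} \<rightarrow> carrier R" and s: "s \<in> carrier R" and e: "e \<in> carrier R"
    and es: "e \<otimes> s = \<zero>" and ann: "\<And>x. x \<in> carrier R \<Longrightarrow> s \<otimes> x = \<zero> \<Longrightarrow> e \<otimes> x = x"
    and fg: "fg_relations R n v"
  shows "fg_relations R n (\<lambda>i. s \<otimes> v i)"
proof -
  let ?F = "free_module R n" and ?u = "\<lambda>i. s \<otimes> v i"
  interpret F: module R ?F by (rule module_free_module)
  have u: "?u \<in> {..<n} \<rightarrow> carrier R" using v s by auto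
  note dot = module_homD[OF dot_hom[OF v]] and dot_u = dot_smult[OF v s]
  obtain Y where Y: "finite Y \<and> Y \<subseteq> relations R n v \<and>
      (\<forall>H. submodule H R ?F \<and> Y \<subseteq> H \<longrightarrow> relations R n v \<subseteq> H)"
    using fg unfolding fg_submodule_iff[OF submodule_relations[OF v]] by (rule exE)
  let ?E = "(\<lambda>k. e \<odot>\<^bsub>?F\<^esub> unit_vec n k) ` {..<n}"
  have "relations R n v \<subseteq> relations R n ?u"
    using dot_u s unfolding relations_eq by (auto simp del: free_module_simps)
  moreover have "?E \<subseteq> relations R n ?u"
  proof
    fix x assume "x \<in> ?E"
    then obtain k where k: "k < n" "x = e \<odot>\<^bsub>?F\<^esub> unit_vec n k" by auto
    have unit: "unit_vec n k \<in> carrier ?F" by simp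
    have x: "x \<in> carrier ?F" unfolding k(2) using F.smult_closed[OF e unit] .
    have "v k \<in> carrier R" using v k(1) by auto
    moreover have "dot n v x = e \<otimes> v k"
      unfolding k(2) using dot(3)[OF e unit] dot_unit_vec[OF v k(1)] by (simp del: free_module_simps)
    ultimately have "dot n ?u x = (e \<otimes> s) \<otimes> v k"
      using dot_u[OF x] e s by (simp add: m_ac)
    then show "x \<in> relations R n ?u"
      using x es \<open>v k \<in> carrier R\<close> by (simp add: relations_eq del: free_module_simps)
  qed
  moreover have "relations R n ?u \<subseteq> H" if H: "submodule H R ?F" "Y \<union> ?E \<subseteq> H" for H
  proof
    fix a assume "a \<in> relations R n ?u"
    then have a: "a \<in> carrier ?F" "s \<otimes> dot n v a = \<zero>"
      using dot_u by (auto simp: relations_eq simp del: free_module_simps)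
    have da: "dot n v a \<in> carrier R" using dot(1)[OF a(1)] by simp
    have e_hom: "(\<lambda>x. e \<odot>\<^bsub>?F\<^esub> x) \<in> module_hom R ?F ?F"
    proof (rule module_homI)
      fix c x assume "c \<in> carrier R" "x \<in> carrier ?F"
      then show "e \<odot>\<^bsub>?F\<^esub> (c \<odot>\<^bsub>?F\<^esub> x) = c \<odot>\<^bsub>?F\<^esub> (e \<odot>\<^bsub>?F\<^esub> x)"
        using e F.smult_assoc1[of e c x] F.smult_assoc1[of c e x] by (simp add: m_comm del: free_module_simps)
    qed (use e F.smult_closed F.smult_r_distr in \<open>simp_all del: free_module_simps\<close>)
    have "{x \<in> carrier ?F. e \<odot>\<^bsub>?F\<^esub> x \<in> H} = {..<n} \<rightarrow>\<^sub>E carrier R"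
      using H(2)
      by (intro submodule_free_module_eq_carrier submodule_vimage[OF module_free_module module_free_module e_hom H(1)])
        (simp add: image_subset_iff)
    then have ea: "e \<odot>\<^bsub>?F\<^esub> a \<in> H" using a(1) by auto
    have eaF: "e \<odot>\<^bsub>?F\<^esub> a \<in> carrier ?F" using F.smult_closed[OF e a(1)] .
    \<comment> \<open>Since \<open>s\<close> kills \<open>dot n v a\<close>, multiplication by
      \<open>e\<close> fixes it, so removing \<open>e a\<close> from \<open>a\<close> leaves a
      relation of \<open>v\<close>.\<close>
    let ?b = "a \<oplus>\<^bsub>?F\<^esub> (\<ominus> \<one>) \<odot>\<^bsub>?F\<^esub> (e \<odot>\<^bsub>?F\<^esub> a)"
    have "(\<ominus> \<one>) \<odot>\<^bsub>?F\<^esub> (e \<odot>\<^bsub>?F\<^esub> a) \<in> carrier ?F" using F.smult_closed[OF _ eaF] by simp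
    moreover from this have "dot n v ?b = dot n v a \<oplus> (\<ominus> \<one>) \<otimes> (e \<otimes> dot n v a)"
      using dot(2)[OF a(1)] dot(3)[OF _ eaF, of "\<ominus> \<one>"] dot(3)[OF e a(1)]
      by (simp del: free_module_simps)
    then have "dot n v ?b = \<zero>"
      using ann[OF da a(2)] da by (simp add: l_minus r_neg del: free_module_simps)
    ultimately have "?b \<in> relations R n v"
      using F.M.a_closed[OF a(1)] unfolding relations_eq by blast
    then have "?b \<in> H" using Y H by auto
    then have "?b \<oplus>\<^bsub>?F\<^esub> e \<odot>\<^bsub>?F\<^esub> a \<in> H"
      using ea H(1) unfolding F.submodule_iff by blast
    moreover have "?b \<oplus>\<^bsub>?F\<^esub> e \<odot>\<^bsub>?F\<^esub> a = a"
      using F.smult_l_minus[OF one_closed eaF] eaF a(1)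
      by (simp add: F.M.a_assoc F.M.l_neg del: free_module_simps)
    ultimately show "a \<in> H" by simp
  qed
  ultimately show ?thesis
    using Y unfolding fg_submodule_iff[OF submodule_relations[OF u]]
    by (intro exI[of _ "Y \<union> ?E"] conjI allI impI) auto
qed

section \<open>Transfer of coherence between R, T and A\<close>

text \<open>\<open>multiple\<close> is the form in which the condition on ideals is used: a vector
  with a non-zero entry becomes, after multiplication by a unit \<open>r\<close> of
  \<open>T\<close>, a regular multiple of a vector that generates the unit ideal of
  \<open>T\<close>.\<close>

locale unimodular_conductor = conductor +
  fixes c
  assumes c_C: "c \<in> C" and c_regular: "t \<in> carrier T \<Longrightarrow> c \<otimes>\<^bsub>T\<^esub> t = \<zero>\<^bsub>T\<^esub> \<Longrightarrow> t = \<zero>\<^bsub>T\<^esub>"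
    and multiple: "u \<in> {..<n::nat} \<rightarrow> carrier R \<Longrightarrow> i < n \<Longrightarrow> u i \<noteq> \<zero>\<^bsub>R\<^esub> \<Longrightarrow>
      \<exists>r\<in>carrier R. \<exists>s\<in>carrier R. \<exists>v \<in> {..<n} \<rightarrow> carrier R. \<exists>w \<in> {..<n} \<rightarrow> carrier T.
        (\<Oplus>\<^bsub>T\<^esub>j\<in>{..<n}. w j \<otimes>\<^bsub>T\<^esub> v j) = \<one>\<^bsub>T\<^esub> \<and> (\<forall>i<n. r \<otimes>\<^bsub>T\<^esub> u i = s \<otimes>\<^bsub>T\<^esub> v i) \<and>
        (\<forall>t\<in>carrier T. s \<otimes>\<^bsub>T\<^esub> t = \<zero>\<^bsub>T\<^esub> \<longrightarrow> t = \<zero>\<^bsub>T\<^esub>) \<and> (\<exists>q\<in>carrier T. q \<otimes>\<^bsub>T\<^esub> r = \<one>\<^bsub>T\<^esub>)"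
begin

lemma unit_regular:
  assumes "r \<in> carrier T" "q \<in> carrier T" "q \<otimes>\<^bsub>T\<^esub> r = \<one>\<^bsub>T\<^esub>" "x \<in> carrier T"
  shows "q \<otimes>\<^bsub>T\<^esub> (r \<otimes>\<^bsub>T\<^esub> x) = x"
  using assms by (simp flip: T.m_assoc)

text \<open>Over \<open>T\<close> both the unit \<open>r\<close> and the element \<open>s\<close>
  are regular, so \<open>u\<close>, the common vector \<open>r u = s v\<close> and \<open>v\<close>
  share their relations.\<close>

lemma relations_T_eq:
  assumes u: "u \<in> {..<n} \<rightarrow> carrier T" and v: "v \<in> {..<n} \<rightarrow> carrier T"
    and r: "r \<in> carrier T" and s: "s \<in> carrier T"
    and uv: "\<And>i. i < n \<Longrightarrow> r \<otimes>\<^bsub>T\<^esub> u i = s \<otimes>\<^bsub>T\<^esub> v i"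
    and s_reg: "\<And>t. t \<in> carrier T \<Longrightarrow> s \<otimes>\<^bsub>T\<^esub> t = \<zero>\<^bsub>T\<^esub> \<Longrightarrow> t = \<zero>\<^bsub>T\<^esub>"
    and q: "q \<in> carrier T" "q \<otimes>\<^bsub>T\<^esub> r = \<one>\<^bsub>T\<^esub>"
  shows "relations T n u = relations T n v"
proof -
  have "relations T n u = relations T n (\<lambda>i. r \<otimes>\<^bsub>T\<^esub> u i)"
  proof (rule T.relations_smult_regular[OF u r, symmetric])
    fix x assume "x \<in> carrier T" "r \<otimes>\<^bsub>T\<^esub> x = \<zero>\<^bsub>T\<^esub>"
    then show "x = \<zero>\<^bsub>T\<^esub>" using unit_regular[OF r q, of x] q(1) by simp
  qed
  also have "\<dots> = relations T n (\<lambda>i. s \<otimes>\<^bsub>T\<^esub> v i)"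
    using v s uv by (intro T.relations_cong) auto
  also have "\<dots> = relations T n v"
    by (rule T.relations_smult_regular[OF v s s_reg])
  finally show ?thesis .
qed

text \<open>The defining sums agree in the two rings. This carries an equality of relation modules
  from \<open>T\<close> down to \<open>R\<close>.\<close>

lemma relations_R_eq:
  assumes "u \<in> {..<n} \<rightarrow> carrier R"
  shows "relations R n u = relations T n u \<inter> ({..<n} \<rightarrow>\<^sub>E carrier R)"
proof -
  have "(\<Oplus>\<^bsub>R\<^esub>i\<in>{..<n}. a i \<otimes>\<^bsub>R\<^esub> u i) = (\<Oplus>\<^bsub>T\<^esub>i\<in>{..<n}. a i \<otimes>\<^bsub>T\<^esub> u i)"
    if "a \<in> {..<n} \<rightarrow>\<^sub>E carrier R" for a
    unfolding mult_eq[symmetric] using assms that by (intro finsum_eq) auto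
  moreover have "a \<in> {..<n} \<rightarrow>\<^sub>E carrier T" if "a \<in> {..<n} \<rightarrow>\<^sub>E carrier R" for a
    using that carrier_subset by (auto simp: PiE_iff)
  ultimately show ?thesis
    unfolding relations_def zero_eq by auto
qed

text \<open>Multiplication by the regular element \<open>c\<close> moves a vector over
  \<open>T\<close> into \<open>C\<close>, hence into \<open>R\<close>, and preserves its relations
  and its being non-zero. The result shares its relations with a unimodular vector, whose relations
  are generated by Koszul relations.\<close>

lemma coherent_ring_T: "coherent_ring T"
  unfolding T.coherent_ring_iff_fg_relations
proof (intro allI ballI)
  fix n :: nat and u assume u: "u \<in> {..<n} \<rightarrow> carrier T"
  show "fg_relations T n u"
  proof (cases "\<forall>i<n. u i = \<zero>\<^bsub>T\<^esub>")
    case True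
    then show ?thesis by (intro T.fg_relations_zero) simp
  next
    case False
    then obtain i where i: "i < n" "u i \<noteq> \<zero>\<^bsub>T\<^esub>" by auto
    let ?cu = "\<lambda>i. c \<otimes>\<^bsub>T\<^esub> u i"
    have cu: "?cu \<in> {..<n} \<rightarrow> carrier R"
      using u C_mult(1)[OF c_C] C_subset by auto
    have cT: "c \<in> carrier T" using c_C C_subset carrier_subset by auto
    have "?cu i \<noteq> \<zero>\<^bsub>R\<^esub>"
      using i u c_regular[of "u i"] by (auto simp: zero_eq)
    from multiple[OF cu i(1) this] obtain r s v w q where
      r: "r \<in> carrier R" and s: "s \<in> carrier R" and v: "v \<in> {..<n} \<rightarrow> carrier R"
      and w: "w \<in> {..<n} \<rightarrow> carrier T" "(\<Oplus>\<^bsub>T\<^esub>j\<in>{..<n}. w j \<otimes>\<^bsub>T\<^esub> v j) = \<one>\<^bsub>T\<^esub>"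
      and uv: "\<forall>i<n. r \<otimes>\<^bsub>T\<^esub> ?cu i = s \<otimes>\<^bsub>T\<^esub> v i"
      and s_reg: "\<forall>t\<in>carrier T. s \<otimes>\<^bsub>T\<^esub> t = \<zero>\<^bsub>T\<^esub> \<longrightarrow> t = \<zero>\<^bsub>T\<^esub>"
      and q: "q \<in> carrier T" "q \<otimes>\<^bsub>T\<^esub> r = \<one>\<^bsub>T\<^esub>"
      by (elim bexE conjE)
    have vT: "v \<in> {..<n} \<rightarrow> carrier T" using v carrier_subset by auto
    have "relations T n u = relations T n ?cu"
      by (rule T.relations_smult_regular[OF u cT c_regular, symmetric])
    also have "\<dots> = relations T n v"
    proof (rule relations_T_eq[OF _ vT])
      show "?cu \<in> {..<n} \<rightarrow> carrier T" using u cT by auto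
      show "r \<in> carrier T" "s \<in> carrier T" using r s carrier_subset by auto
    qed (use uv s_reg q in auto)
    finally show ?thesis using T.fg_relations_unimodular[OF vT w] by simp
  qed
qed

text \<open>Both directions compare a vector with the associated \<open>v\<close>, whose relations
  are finitely generated over \<open>R\<close> exactly when they are over \<open>A\<close>. From
  \<open>R\<close> to \<open>A\<close> one has to return from \<open>v\<close> to \<open>b\<close>
  modulo \<open>C\<close>, where \<open>s\<close> may become a zero divisor; \<open>ann\<close>
  provides the missing generators.\<close>

lemma coherent_ring_R_iff:
  assumes ann: "\<And>s. s \<in> carrier A \<Longrightarrow>
    \<exists>e\<in>carrier A. e \<otimes>\<^bsub>A\<^esub> s = \<zero>\<^bsub>A\<^esub> \<and> (\<forall>x\<in>carrier A. s \<otimes>\<^bsub>A\<^esub> x = \<zero>\<^bsub>A\<^esub> \<longrightarrow> e \<otimes>\<^bsub>A\<^esub> x = x)"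
  shows "coherent_ring R \<longleftrightarrow> coherent_ring A"
proof
  note \<eta> = ring_hom_closed[OF \<eta>_hom] ring_hom_mult[OF \<eta>_hom]
  {
    assume A: "coherent_ring A"
    show "coherent_ring R"
      unfolding R.coherent_ring_iff_fg_relations
    proof (intro allI ballI)
      fix n :: nat and u assume u: "u \<in> {..<n} \<rightarrow> carrier R"
      show "fg_relations R n u"
      proof (cases "\<forall>i<n. u i = \<zero>\<^bsub>R\<^esub>")
        case True
        then show ?thesis by (intro R.fg_relations_zero) simp
      next
        case False
        then obtain i where i: "i < n" "u i \<noteq> \<zero>\<^bsub>R\<^esub>" by auto
        from multiple[OF u i] obtain r s v w q where
          r: "r \<in> carrier R" and s: "s \<in> carrier R" and v: "v \<in> {..<n} \<rightarrow> carrier R"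
          and w: "w \<in> {..<n} \<rightarrow> carrier T" "(\<Oplus>\<^bsub>T\<^esub>j\<in>{..<n}. w j \<otimes>\<^bsub>T\<^esub> v j) = \<one>\<^bsub>T\<^esub>"
          and uv: "\<forall>i<n. r \<otimes>\<^bsub>T\<^esub> u i = s \<otimes>\<^bsub>T\<^esub> v i"
          and s_reg: "\<forall>t\<in>carrier T. s \<otimes>\<^bsub>T\<^esub> t = \<zero>\<^bsub>T\<^esub> \<longrightarrow> t = \<zero>\<^bsub>T\<^esub>"
          and q: "q \<in> carrier T" "q \<otimes>\<^bsub>T\<^esub> r = \<one>\<^bsub>T\<^esub>"
          by (elim bexE conjE)
        have "relations T n u = relations T n v"
        proof (rule relations_T_eq)
          show "u \<in> {..<n} \<rightarrow> carrier T" "v \<in> {..<n} \<rightarrow> carrier T" "r \<in> carrier T" "s \<in> carrier T"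
            using u v r s carrier_subset by auto
        qed (use uv s_reg q in auto)
        then have "relations R n u = relations R n v"
          using relations_R_eq[OF u] relations_R_eq[OF v] by simp
        moreover have "(\<lambda>i. \<eta> (v i)) \<in> {..<n} \<rightarrow> carrier A"
          using v \<eta>(1) by auto
        then have "fg_relations A n (\<lambda>i. \<eta> (v i))"
          using A unfolding A.coherent_ring_iff_fg_relations by simp
        then have "fg_relations R n v"
          using fg_relations_quotient[OF v w] by simp
        ultimately show ?thesis by simp
      qed
    qed
  next
    assume R: "coherent_ring R"
    show "coherent_ring A"
      unfolding A.coherent_ring_iff_fg_relations
    proof (intro allI ballI)
      fix n :: nat and b assume b: "b \<in> {..<n} \<rightarrow> carrier A"
      show "fg_relations A n b"
      proof (cases "\<forall>i<n. b i = \<zero>\<^bsub>A\<^esub>")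
        case True
        then show ?thesis by (intro A.fg_relations_zero) simp
      next
        case False
        then obtain i where i: "i < n" "b i \<noteq> \<zero>\<^bsub>A\<^esub>" by auto
        obtain u where u: "u \<in> carrier (free_module R n)" "\<forall>i\<in>{..<n}. b i = \<eta> (u i)"
          by (rule lift_vec[OF b])
        then have uR: "u \<in> {..<n} \<rightarrow> carrier R" by auto
        have "u i \<noteq> \<zero>\<^bsub>R\<^esub>"
        proof
          assume "u i = \<zero>\<^bsub>R\<^esub>"
          moreover have "\<zero>\<^bsub>R\<^esub> \<in> C"
            using additive_subgroup.zero_closed[OF ideal.axioms(1)[OF C_ideal]] zero_eq by simp
          ultimately show False using i u(2) \<eta>_kernel[OF R.zero_closed] by simp
        qed
        from multiple[OF uR i(1) this] obtain r s v w q where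
          r: "r \<in> carrier R" and s: "s \<in> carrier R" and v: "v \<in> {..<n} \<rightarrow> carrier R"
          and w: "w \<in> {..<n} \<rightarrow> carrier T" "(\<Oplus>\<^bsub>T\<^esub>j\<in>{..<n}. w j \<otimes>\<^bsub>T\<^esub> v j) = \<one>\<^bsub>T\<^esub>"
          and uv: "\<forall>i<n. r \<otimes>\<^bsub>T\<^esub> u i = s \<otimes>\<^bsub>T\<^esub> v i"
          and q: "q \<in> carrier T" "q \<otimes>\<^bsub>T\<^esub> r = \<one>\<^bsub>T\<^esub>"
          by (elim bexE conjE)
        have rT: "r \<in> carrier T" using r carrier_subset by auto
        have \<eta>v: "(\<lambda>i. \<eta> (v i)) \<in> {..<n} \<rightarrow> carrier A"
          using v \<eta>(1) by auto
        have fg: "fg_relations A n (\<lambda>i. \<eta> (v i))"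
          using R v fg_relations_quotient[OF v w] unfolding R.coherent_ring_iff_fg_relations by simp
        obtain e where e: "e \<in> carrier A" "e \<otimes>\<^bsub>A\<^esub> \<eta> s = \<zero>\<^bsub>A\<^esub>"
          "\<forall>x\<in>carrier A. \<eta> s \<otimes>\<^bsub>A\<^esub> x = \<zero>\<^bsub>A\<^esub> \<longrightarrow> e \<otimes>\<^bsub>A\<^esub> x = x"
          using ann[OF \<eta>(1)[OF s]] by (elim bexE conjE)
        have "fg_relations A n (\<lambda>i. \<eta> s \<otimes>\<^bsub>A\<^esub> \<eta> (v i))"
          using e(3) by (intro A.fg_relations_smult[OF \<eta>v \<eta>(1)[OF s] e(1,2) _ fg]) simp
        moreover have "relations A n (\<lambda>i. \<eta> r \<otimes>\<^bsub>A\<^esub> b i) = relations A n (\<lambda>i. \<eta> s \<otimes>\<^bsub>A\<^esub> \<eta> (v i))"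
        proof (rule A.relations_cong)
          fix i assume i: "i < n"
          have "\<eta> (r \<otimes>\<^bsub>R\<^esub> u i) = \<eta> (s \<otimes>\<^bsub>R\<^esub> v i)" using uv i by (simp add: mult_eq)
          moreover have "u i \<in> carrier R" "v i \<in> carrier R" using uR v i by auto
          ultimately show "\<eta> r \<otimes>\<^bsub>A\<^esub> b i = \<eta> s \<otimes>\<^bsub>A\<^esub> \<eta> (v i)"
            using \<eta>(2) r s u(2) i by simp
        qed (use \<eta>(1) s v in auto)
        \<comment> \<open>\<open>\<eta> r\<close> is regular in \<open>A\<close> although the
          inverse \<open>q\<close> of \<open>r\<close> is only known to lie in \<open>T\<close>: if
          \<open>r x\<close> is in \<open>C\<close>, then so is \<open>x = q (r x)\<close>, because
          \<open>C\<close> is an ideal of \<open>T\<close>.\<close>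
        moreover have "relations A n (\<lambda>i. \<eta> r \<otimes>\<^bsub>A\<^esub> b i) = relations A n b"
        proof (rule A.relations_smult_regular[OF b \<eta>(1)[OF r]])
          fix y assume y: "y \<in> carrier A" "\<eta> r \<otimes>\<^bsub>A\<^esub> y = \<zero>\<^bsub>A\<^esub>"
          then obtain x where x: "x \<in> carrier R" "y = \<eta> x" using \<eta>_surj by blast
          then have "r \<otimes>\<^bsub>T\<^esub> x \<in> C"
            using \<eta>_kernel[of "r \<otimes>\<^bsub>R\<^esub> x"] \<eta>(2)[OF r x(1)] y(2) r by (simp add: mult_eq[symmetric])
          then have "q \<otimes>\<^bsub>T\<^esub> (r \<otimes>\<^bsub>T\<^esub> x) \<in> C" using C_mult(2) q(1) by simp
          moreover have "x \<in> carrier T" using x(1) carrier_subset by auto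
          ultimately have "x \<in> C" using unit_regular[OF rT q] by simp
          then show "y = \<zero>\<^bsub>A\<^esub>" using \<eta>_kernel[OF x(1)] x(2) by simp
        qed
        ultimately show ?thesis by simp
      qed
    qed
  }
qed

end

text \<open>The zero of the factor ring is the coset \<open>C\<close> itself, so the elements sent
  to zero by the projection are those of \<open>C\<close>. This places the factor ring in the
  setting of the locale.\<close>

lemma conductor_quotient:
  assumes T: "cring T" and R: "subring R T" and C: "common_ideal T R C"
  shows "conductor (T\<lparr>carrier := R\<rparr>) T (T\<lparr>carrier := R\<rparr> Quot C) C (\<lambda>x. C +>\<^bsub>T\<lparr>carrier := R\<rparr>\<^esub> x)"
proof -
  let ?R = "T\<lparr>carrier := R\<rparr>"
  interpret T: cring T by fact
  have CT: "ideal C T" and CR: "ideal C ?R" using C by (auto simp: common_ideal_def)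
  interpret CR: ideal C ?R by (rule CR)
  have sub: "R \<subseteq> carrier T" using subringE(1)[OF R] .
  have R': "cring ?R"
    using T.subcringI'[OF R] T.subcring_iff[OF sub] by simp
  have zero: "C +>\<^bsub>?R\<^esub> x = C \<longleftrightarrow> x \<in> C" if "x \<in> R" for x
    using CR.a_rcos_const CR.rcos_const_imp_mem that by auto
  show ?thesis
  proof (intro conductor.intro overring.intro overring_axioms.intro conductor_axioms.intro)
    show "cring (?R Quot C)" by (rule CR.quotient_is_cring[OF R'])
    show "(\<lambda>x. C +>\<^bsub>?R\<^esub> x) \<in> ring_hom ?R (?R Quot C)" by (rule CR.rcos_ring_hom)
    show "(\<lambda>x. C +>\<^bsub>?R\<^esub> x) ` carrier ?R = carrier (?R Quot C)"
      by (auto simp: FactRing_def A_RCOSETS_defs a_r_coset_def)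
    show "C +>\<^bsub>?R\<^esub> x = \<zero>\<^bsub>?R Quot C\<^esub> \<longleftrightarrow> x \<in> C" if "x \<in> carrier ?R" for x
      using zero that by (simp add: FactRing_def)
  qed (use T R' sub CT CR.Icarr in auto)
qed

theorem theorem4p10:
  fixes T :: "'a ring" and R C :: "'a set" and A :: "'a set ring"
    and L :: "'l set" and D :: "'l \<Rightarrow> 'b ring"
  assumes "regular_conductor_square T R C"
    and "A = T\<lparr>carrier := R\<rparr> Quot C"
    and "flat_module (T\<lparr>carrier := R\<rparr>) (mult_module T (carrier T))"
    and "principalideal C T"
    and "\<And>I. fg_ideal I (T\<lparr>carrier := R\<rparr>) \<Longrightarrow> I \<noteq> {\<zero>\<^bsub>T\<^esub>} \<Longrightarrow> conductor_ideal_condition T R I"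
    and "\<And>l. l \<in> L \<Longrightarrow> domain (D l)"
    and "A \<simeq> product_ring L D"
  shows "(coherent_ring (T\<lparr>carrier := R\<rparr>) \<longleftrightarrow> coherent_ring A) \<and>
    (coherent_ring (T\<lparr>carrier := R\<rparr>) \<longrightarrow> coherent_ring T \<and> (\<forall>l\<in>L. coherent_ring (D l))) \<and>
    (coherent_ring A \<longrightarrow> coherent_ring T \<and> (\<forall>l\<in>L. coherent_ring (D l)))"
proof -
  let ?R = "T\<lparr>carrier := R\<rparr>"
  let ?\<eta> = "\<lambda>x. C +>\<^bsub>?R\<^esub> x"
  have "cring T" "subring R T" "common_ideal T R C"
    using assms(1) by (auto simp: regular_conductor_square_def conductor_square_def)
  then have cond: "conductor ?R T A C ?\<eta>"
    unfolding assms(2) by (rule conductor_quotient)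
  then interpret conductor ?R T A C ?\<eta> .
  obtain c where c: "c \<in> C" "\<forall>t\<in>carrier T. c \<otimes>\<^bsub>T\<^esub> t = \<zero>\<^bsub>T\<^esub> \<longrightarrow> t = \<zero>\<^bsub>T\<^esub>"
    using assms(1) by (auto simp: regular_conductor_square_def)
  interpret unimodular_conductor ?R T A C ?\<eta> c
  proof (intro unimodular_conductor.intro unimodular_conductor_axioms.intro cond)
    fix u i and n :: nat
    assume u: "u \<in> {..<n} \<rightarrow> carrier ?R" and i: "i < n" "u i \<noteq> \<zero>\<^bsub>?R\<^esub>"
    let ?I = "Idl\<^bsub>?R\<^esub> (u ` {..<n})"
    \<comment> \<open>The ideal contains the non-zero entry \<open>u i\<close>, so the condition on
      ideals applies to it.\<close>
    have "u i \<in> ?I" using R.genideal_self[of "u ` {..<n}"] u i(1) by auto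
    then have "?I \<noteq> {\<zero>\<^bsub>T\<^esub>}" using i(2) by auto
    moreover have "fg_ideal ?I ?R"
      unfolding R.fg_ideal_iff by (intro exI[of _ n] exI[of _ u] conjI refl u)
    ultimately have "conductor_ideal_condition T R ?I" using assms(5) by blast
    then obtain r s U where r: "r \<in> R" and s: "s \<in> R" and U: "ideal U ?R"
      and UT: "Idl\<^bsub>T\<^esub> U = carrier T" and rT: "PIdl\<^bsub>T\<^esub> r = carrier T"
      and rs: "r <#\<^bsub>T\<^esub> ?I = s <#\<^bsub>T\<^esub> U"
      and "(\<lambda>x. s \<otimes>\<^bsub>T\<^esub> x) \<in> module_iso ?R (mult_module T U) (mult_module T (s <#\<^bsub>T\<^esub> U))"
      unfolding conductor_ideal_condition_def by (elim bexE exE conjE)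
    then have inj: "inj_on (\<lambda>x. s \<otimes>\<^bsub>T\<^esub> x) U"
      by (simp add: module_iso_def bij_betw_def)
    show "\<exists>r\<in>carrier ?R. \<exists>s\<in>carrier ?R. \<exists>v \<in> {..<n} \<rightarrow> carrier ?R. \<exists>w \<in> {..<n} \<rightarrow> carrier T.
        (\<Oplus>\<^bsub>T\<^esub>j\<in>{..<n}. w j \<otimes>\<^bsub>T\<^esub> v j) = \<one>\<^bsub>T\<^esub> \<and> (\<forall>i<n. r \<otimes>\<^bsub>T\<^esub> u i = s \<otimes>\<^bsub>T\<^esub> v i) \<and>
        (\<forall>t\<in>carrier T. s \<otimes>\<^bsub>T\<^esub> t = \<zero>\<^bsub>T\<^esub> \<longrightarrow> t = \<zero>\<^bsub>T\<^esub>) \<and> (\<exists>q\<in>carrier T. q \<otimes>\<^bsub>T\<^esub> r = \<one>\<^bsub>T\<^esub>)"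
      using r s c by (intro bexI[of _ r] bexI[of _ s] unimodular_multiple[OF c(1) _ u _ _ U UT rT rs inj]) auto
  qed (use c in auto)
  obtain h where "h \<in> ring_iso A (product_ring L D)"
    using assms(7) by (auto simp: is_ring_iso_def)
  then interpret P: domain_product A L D h
    using assms(6) by (intro domain_product.intro domain_product_axioms.intro A.is_cring)
  \<comment> \<open>The idempotents found in the product of domains supply the annihilator condition
    of \<open>coherent_ring_R_iff\<close>.\<close>
  have "coherent_ring ?R \<longleftrightarrow> coherent_ring A"
    by (rule coherent_ring_R_iff[OF P.annihilator_idempotent])
  then show ?thesis
    using coherent_ring_T P.coherent_ring_factor by blast
qed

end
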